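(* Let $k,n>1$ be integers and suppose $n$ has a divisor $p$ with $p\neq1$, $p\neq n$ and $p<k$ ($p$ a positive integer). Then the lattices $G_1,G_3<\operatorname{Aut}(X_{k,kn})$ described in the context (where $G_3$ is defined using $p$) are not abstractly commensurable.
   Context: Labeled graphs. A labeled graph is a connected graph in which each edge carries a non-zero integer at each of its two ends. It defines a graph of groups with all vertex and edge groups $\mathbb{Z}$, where the inclusion of an edge group into the vertex group at one of its ends is multiplication by the label at that end. The group defined by a labeled graph is the fundamental group of this graph of groups. The groups. Each is defined by a labeled graph with exactly two vertices $v$ and $u$, all edges joining $v$ to $u$; an edge with labels $(x,y)$ has label $x$ at $v$ and $y$ at $u$. - $G_1$: two edges, with labels $(k,kn)$ and $(kn,k)$. (It is the index-2 subgroup $\langle a,tat^{-1},t^2\rangle$ of $BS(k,kn)=\langle a,t\mid ta^kt^{-1}=a^{kn}\rangle$.) - $G_3$: $k$ edges with labels $(n,1)$, $k-p$ edges with labels $(1,n)$, and one edge with labels $(p,pn)$. Both groups act freely and cocompactly on the 2-complex $X_{k,kn}$ and are thereby uniform lattices in the locally compact group $\operatorname{Aut}(X_{k,kn})$. Here $X_{k,kn}$ is the universal cover, with induced cell structure, of the 2-complex with one vertex, 1-cells $a,t_0,\dots,t_{k-1}$ and $k$ 2-cells attached along $t_iat_{i+1}^{-1}a^{-n}$ (indices modulo $k$), and $\operatorname{Aut}$ denotes the group of cell-structure-preserving homeomorphisms modulo those inducing the identity on the set of cells, topologized by the subbasis $\{f\mid f(\sigma)=\tau\}$, $\sigma,\tau$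 cells. Two groups are abstractly commensurable if they have isomorphic finite-index subgroups. *)

theory Defs
  imports "HOL-Algebra.Coset"
begin

section \<open>Groups given by generators and relators\<close>

text \<open>A letter \<open>(x, True)\<close> stands for the generator \<open>x\<close> and \<open>(x, False)\<close> for its inverse.\<close>

type_synonym 'g word = "('g \<times> bool) list"

definition words :: "'g set \<Rightarrow> 'g word set" where
  "words S = lists (S \<times> UNIV)"

inductive_set word_cong :: "'g set \<Rightarrow> 'g word set \<Rightarrow> ('g word \<times> 'g word) set"
  for S :: "'g set" and R :: "'g word set" where
  refl: "w \<in> words S \<Longrightarrow> (w, w) \<in> word_cong S R"
| sym: "(w, w') \<in> word_cong S R \<Longrightarrow> (w', w) \<in> word_cong S R"
| trans: "(w, w') \<in> word_cong S R \<Longrightarrow> (w', w'') \<in> word_cong S R \<Longrightarrow> (w, w'') \<in> word_cong S R"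
| cancel: "u \<in> words S \<Longrightarrow> w \<in> words S \<Longrightarrow> x \<in> S \<Longrightarrow>
    (u @ [(x, b), (x, \<not> b)] @ w, u @ w) \<in> word_cong S R"
| relator: "u \<in> words S \<Longrightarrow> w \<in> words S \<Longrightarrow> r \<in> R \<Longrightarrow> (u @ r @ w, u @ w) \<in> word_cong S R"

definition presented_group :: "'g set \<Rightarrow> 'g word set \<Rightarrow> 'g word set monoid" where
  "presented_group S R =
     \<lparr>carrier = words S // word_cong S R,
      monoid.mult = (\<lambda>X Y. \<Union>x\<in>X. \<Union>y\<in>Y. word_cong S R `` {x @ y}),
      one = word_cong S R `` {[]}\<rparr>"

definition word_pow :: "'g \<Rightarrow> int \<Rightarrow> 'g word" where
  "word_pow x i = replicate (nat \<bar>i\<bar>) (x, i \<ge> 0)"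

definition word_inv :: "'g word \<Rightarrow> 'g word" where
  "word_inv w = rev (map (\<lambda>(x, b). (x, \<not> b)) w)"


section \<open>Labeled graphs and their groups\<close>

text \<open>The orientation of an edge (from \<open>tail\<close> to \<open>head\<close>) is auxiliary: it only names its two ends.\<close>

record ('v, 'e) lgraph =
  verts :: "'v set"
  edges :: "'e set"
  tail :: "'e \<Rightarrow> 'v"
  head :: "'e \<Rightarrow> 'v"
  tail_label :: "'e \<Rightarrow> int"
  head_label :: "'e \<Rightarrow> int"

definition connected_by :: "('v, 'e) lgraph \<Rightarrow> 'e set \<Rightarrow> bool" where
  "connected_by \<Gamma> T \<longleftrightarrow>
     (let A = (\<lambda>e. (tail \<Gamma> e, head \<Gamma> e)) ` T
      in \<forall>x\<in>verts \<Gamma>. \<forall>y\<in>verts \<Gamma>. (x, y) \<in> (A \<union> A\<inverse>)\<^sup>*)"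

definition labeled_graph :: "('v, 'e) lgraph \<Rightarrow> bool" where
  "labeled_graph \<Gamma> \<longleftrightarrow>
     verts \<Gamma> \<noteq> {} \<and> tail \<Gamma> ` edges \<Gamma> \<subseteq> verts \<Gamma> \<and> head \<Gamma> ` edges \<Gamma> \<subseteq> verts \<Gamma> \<and>
     connected_by \<Gamma> (edges \<Gamma>) \<and>
     (\<forall>e\<in>edges \<Gamma>. tail_label \<Gamma> e \<noteq> 0 \<and> head_label \<Gamma> e \<noteq> 0)"

text \<open>Spanning trees are the minimal edge sets that connect all vertices.\<close>

definition spanning_tree :: "('v, 'e) lgraph \<Rightarrow> 'e set \<Rightarrow> bool" where
  "spanning_tree \<Gamma> T \<longleftrightarrow>
     T \<subseteq> edges \<Gamma> \<and> connected_by \<Gamma> T \<and> (\<forall>e\<in>T. \<not> connected_by \<Gamma> (T - {e}))"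

datatype ('v, 'e) gog_gen = Vertex_gen 'v | Edge_gen 'e

text \<open>The relation for an edge \<open>e\<close> is \<open>t\<^sub>e b\<^sup>y t\<^sub>e\<inverse> = a\<^sup>x\<close>, where \<open>a\<close> and \<open>b\<close> generate the
  vertex groups at the tail and the head of \<open>e\<close>, and \<open>x\<close> and \<open>y\<close> are the labels there.\<close>

definition edge_relator :: "('v, 'e) lgraph \<Rightarrow> 'e \<Rightarrow> ('v, 'e) gog_gen word" where
  "edge_relator \<Gamma> e =
     [(Edge_gen e, True)] @ word_pow (Vertex_gen (head \<Gamma> e)) (head_label \<Gamma> e) @
     [(Edge_gen e, False)] @ word_inv (word_pow (Vertex_gen (tail \<Gamma> e)) (tail_label \<Gamma> e))"

text \<open>The fundamental group of the graph of infinite cyclic groups defined by \<open>\<Gamma>\<close>, with respect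
  to a spanning tree \<open>T\<close>. Up to isomorphism it does not depend on \<open>T\<close>.\<close>

definition gog_gens :: "('v, 'e) lgraph \<Rightarrow> ('v, 'e) gog_gen set" where
  "gog_gens \<Gamma> = Vertex_gen ` verts \<Gamma> \<union> Edge_gen ` edges \<Gamma>"

definition gog_relators :: "('v, 'e) lgraph \<Rightarrow> 'e set \<Rightarrow> ('v, 'e) gog_gen word set" where
  "gog_relators \<Gamma> T = edge_relator \<Gamma> ` edges \<Gamma> \<union> (\<lambda>e. [(Edge_gen e, True)]) ` T"

definition gog_group :: "('v, 'e) lgraph \<Rightarrow> 'e set \<Rightarrow> ('v, 'e) gog_gen word set monoid" where
  "gog_group \<Gamma> T = presented_group (gog_gens \<Gamma>) (gog_relators \<Gamma> T)"


section \<open>Abstract commensurability\<close>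

definition abstractly_commensurable :: "('a, 'c) monoid_scheme \<Rightarrow> ('b, 'd) monoid_scheme \<Rightarrow> bool"
  where
  "abstractly_commensurable G G' \<longleftrightarrow>
     (\<exists>H H'. subgroup H G \<and> finite (rcosets\<^bsub>G\<^esub> H) \<and>
             subgroup H' G' \<and> finite (rcosets\<^bsub>G'\<^esub> H') \<and>
             G\<lparr>carrier := H\<rparr> \<cong> G'\<lparr>carrier := H'\<rparr>)"


section \<open>The two lattices\<close>

datatype two_verts = V | U

text \<open>The list gives, for each edge, the pair of its labels at \<open>V\<close> and at \<open>U\<close>.\<close>

definition two_vertex_graph :: "(int \<times> int) list \<Rightarrow> (two_verts, nat) lgraph" where
  "two_vertex_graph L =
     \<lparr>verts = {V, U}, edges = {..<length L}, tail = (\<lambda>_. V), head = (\<lambda>_. U),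
      tail_label = (\<lambda>i. fst (L ! i)), head_label = (\<lambda>i. snd (L ! i))\<rparr>"

definition graph1 :: "nat \<Rightarrow> nat \<Rightarrow> (two_verts, nat) lgraph" where
  "graph1 k n = two_vertex_graph [(int k, int (k * n)), (int (k * n), int k)]"

definition graph3 :: "nat \<Rightarrow> nat \<Rightarrow> nat \<Rightarrow> (two_verts, nat) lgraph" where
  "graph3 k n p = two_vertex_graph
     (replicate k (int n, 1) @ replicate (k - p) (1, int n) @ [(int p, int (p * n))])"

text \<open>As spanning tree we take the first edge in the list.\<close>

definition G1 :: "nat \<Rightarrow> nat \<Rightarrow> (two_verts, nat) gog_gen word set monoid" where
  "G1 k n = gog_group (graph1 k n) {0}"

definition G3 :: "nat \<Rightarrow> nat \<Rightarrow> nat \<Rightarrow> (two_verts, nat) gog_gen word set monoid" where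
  "G3 k n p = gog_group (graph3 k n p) {0}"


section \<open>Well-definedness\<close>

lemma words_append [simp]: "u @ w \<in> words S \<longleftrightarrow> u \<in> words S \<and> w \<in> words S"
  by (auto simp: words_def)

lemma words_Nil [simp]: "[] \<in> words S"
  by (simp add: words_def)

lemma words_Cons [simp]: "(x, b) # w \<in> words S \<longleftrightarrow> x \<in> S \<and> w \<in> words S"
  by (auto simp: words_def)

lemma word_inv_in_words [simp]: "word_inv w \<in> words S \<longleftrightarrow> w \<in> words S"
  by (induction w) (auto simp: word_inv_def)

lemma word_pow_in_words: "x \<in> S \<Longrightarrow> word_pow x i \<in> words S"
  by (auto simp: words_def word_pow_def)

context
  fixes S :: "'g set" and R :: "'g word set"
  assumes R: "R \<subseteq> words S"
begin

lemma word_cong_in_words: "(w, w') \<in> word_cong S R \<Longrightarrow> w \<in> words S \<and> w' \<in> words S"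
  by (induction rule: word_cong.induct) (use R in auto)

lemma equiv_word_cong: "equiv (words S) (word_cong S R)"
proof (rule equivI)
  show "word_cong S R \<subseteq> words S \<times> words S"
    using word_cong_in_words by auto
  show "refl_on (words S) (word_cong S R)"
    by (auto simp: refl_on_def intro: word_cong.refl)
  show "sym (word_cong S R)"
    by (rule symI) (rule word_cong.sym)
  show "trans (word_cong S R)"
    by (rule transI) (rule word_cong.trans)
qed

lemma word_cong_context:
  "(w, w') \<in> word_cong S R \<Longrightarrow> u \<in> words S \<Longrightarrow> v \<in> words S \<Longrightarrow>
    (u @ w @ v, u @ w' @ v) \<in> word_cong S R"
proof (induction rule: word_cong.induct)
  case (cancel a c x b)
  then show ?case
    using word_cong.cancel[of "u @ a" S "c @ v" x b R] by simp
next
  case (relator a c r)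
  then show ?case
    using word_cong.relator[of "u @ a" S "c @ v" r R] by simp
next
  case (trans w w' w'')
  then show ?case by (meson word_cong.trans)
next
  case (sym w w')
  then show ?case by (meson word_cong.sym)
next
  case (refl w)
  then show ?case by (simp add: word_cong.refl)
qed

lemma word_cong_append:
  assumes "(w, w') \<in> word_cong S R" "(v, v') \<in> word_cong S R"
  shows "(w @ v, w' @ v') \<in> word_cong S R"
proof -
  have "(w @ v, w' @ v) \<in> word_cong S R"
    using word_cong_context[OF assms(1), of "[]" v] word_cong_in_words[OF assms(2)] by simp
  moreover have "(w' @ v, w' @ v') \<in> word_cong S R"
    using word_cong_context[OF assms(2), of w' "[]"] word_cong_in_words[OF assms(1)] by simp
  ultimately show ?thesis by (rule word_cong.trans)
qed

lemma word_cong_word_inv: "w \<in> words S \<Longrightarrow> (word_inv w @ w, []) \<in> word_cong S R"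
proof (induction w)
  case Nil
  then show ?case by (simp add: word_inv_def word_cong.refl)
next
  case (Cons l w)
  obtain x b where l: "l = (x, b)" by fastforce
  have "(word_inv w @ [(x, \<not> b), (x, \<not> \<not> b)] @ w, word_inv w @ w) \<in> word_cong S R"
    using Cons.prems l by (intro word_cong.cancel) simp_all
  moreover have "(word_inv w @ w, []) \<in> word_cong S R"
    using Cons l by simp
  ultimately have "(word_inv w @ [(x, \<not> b), (x, \<not> \<not> b)] @ w, []) \<in> word_cong S R"
    by (rule word_cong.trans)
  then show ?case
    by (simp add: l word_inv_def)
qed

lemma presented_group_mult:
  assumes "x \<in> words S" "y \<in> words S"
  shows "word_cong S R `` {x} \<otimes>\<^bsub>presented_group S R\<^esub> word_cong S R `` {y} =
         word_cong S R `` {x @ y}"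
proof -
  have eq: "word_cong S R `` {a @ b} = word_cong S R `` {x @ y}"
    if "a \<in> word_cong S R `` {x}" "b \<in> word_cong S R `` {y}" for a b
    using equiv_class_eq[OF equiv_word_cong word_cong_append[of x a y b]] that by simp
  have "x \<in> word_cong S R `` {x}" "y \<in> word_cong S R `` {y}"
    using assms by (simp_all add: word_cong.refl)
  then have "(\<Union>a\<in>word_cong S R `` {x}. \<Union>b\<in>word_cong S R `` {y}. word_cong S R `` {a @ b}) =
      word_cong S R `` {x @ y}"
    using eq by blast
  then show ?thesis
    by (simp add: presented_group_def)
qed

lemma group_presented_group: "group (presented_group S R)"
proof -
  let ?C = "\<lambda>w. word_cong S R `` {w}"
  have carr: "X \<in> carrier (presented_group S R) \<longleftrightarrow> (\<exists>w\<in>words S. X = ?C w)" for X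
    by (auto simp: presented_group_def quotient_def)
  have one: "\<one>\<^bsub>presented_group S R\<^esub> = ?C []"
    by (simp add: presented_group_def)
  show ?thesis
  proof (rule groupI)
    fix X assume "X \<in> carrier (presented_group S R)"
    then obtain w where w: "w \<in> words S" "X = ?C w" by (auto simp: carr)
    have "?C (word_inv w) \<otimes>\<^bsub>presented_group S R\<^esub> X = ?C []"
      using w equiv_class_eq[OF equiv_word_cong word_cong_word_inv]
      by (simp add: presented_group_mult)
    moreover have "?C (word_inv w) \<in> carrier (presented_group S R)"
      unfolding carr using w by auto
    ultimately show
      "\<exists>Y\<in>carrier (presented_group S R). Y \<otimes>\<^bsub>presented_group S R\<^esub> X = \<one>\<^bsub>presented_group S R\<^esub>"
      unfolding one by blast
  next
    show "\<one>\<^bsub>presented_group S R\<^esub> \<in> carrier (presented_group S R)"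
      unfolding carr one by (rule bexI[of _ "[]"]) simp_all
  next
    fix X Y assume "X \<in> carrier (presented_group S R)" "Y \<in> carrier (presented_group S R)"
    then obtain x y where xy: "x \<in> words S" "y \<in> words S" "X = ?C x" "Y = ?C y"
      by (auto simp: carr)
    show "X \<otimes>\<^bsub>presented_group S R\<^esub> Y \<in> carrier (presented_group S R)"
      unfolding carr using xy by (intro bexI[of _ "x @ y"]) (simp_all add: presented_group_mult)
  next
    fix X Y Z
    assume "X \<in> carrier (presented_group S R)" "Y \<in> carrier (presented_group S R)"
      "Z \<in> carrier (presented_group S R)"
    then obtain x y z where "x \<in> words S" "y \<in> words S" "z \<in> words S"
      "X = ?C x" "Y = ?C y" "Z = ?C z"
      by (auto simp: carr)
    then show "X \<otimes>\<^bsub>presented_group S R\<^esub> Y \<otimes>\<^bsub>presented_group S R\<^esub> Z =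
        X \<otimes>\<^bsub>presented_group S R\<^esub> (Y \<otimes>\<^bsub>presented_group S R\<^esub> Z)"
      by (simp add: presented_group_mult)
  next
    fix X assume "X \<in> carrier (presented_group S R)"
    then obtain x where "x \<in> words S" "X = ?C x"
      by (auto simp: carr)
    then show "\<one>\<^bsub>presented_group S R\<^esub> \<otimes>\<^bsub>presented_group S R\<^esub> X = X"
      by (simp add: one presented_group_mult)
  qed
qed

end

lemma group_gog_group:
  assumes "labeled_graph \<Gamma>" "spanning_tree \<Gamma> T"
  shows "group (gog_group \<Gamma> T)"
  unfolding gog_group_def
proof (rule group_presented_group)
  have gens: "Edge_gen e \<in> gog_gens \<Gamma> \<and> Vertex_gen (tail \<Gamma> e) \<in> gog_gens \<Gamma> \<and>
      Vertex_gen (head \<Gamma> e) \<in> gog_gens \<Gamma>" if "e \<in> edges \<Gamma>" for e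
    using assms(1) that unfolding labeled_graph_def gog_gens_def by blast
  have "T \<subseteq> edges \<Gamma>"
    using assms(2) by (simp add: spanning_tree_def)
  have "edge_relator \<Gamma> e \<in> words (gog_gens \<Gamma>)" if "e \<in> edges \<Gamma>" for e
    using gens[OF that] by (simp add: edge_relator_def word_pow_in_words)
  moreover have "[(Edge_gen e, True)] \<in> words (gog_gens \<Gamma>)" if "e \<in> T" for e
    using gens \<open>T \<subseteq> edges \<Gamma>\<close> that by auto
  ultimately show "gog_relators \<Gamma> T \<subseteq> words (gog_gens \<Gamma>)"
    unfolding gog_relators_def by blast
qed

lemma connected_by_two_vertex_graph:
  "connected_by (two_vertex_graph L) T \<longleftrightarrow> T \<noteq> {}"
proof
  assume "connected_by (two_vertex_graph L) T"
  then show "T \<noteq> {}"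
    by (auto simp: connected_by_def two_vertex_graph_def)
next
  assume "T \<noteq> {}"
  define A where "A = (\<lambda>e. (tail (two_vertex_graph L) e, head (two_vertex_graph L) e)) ` T"
  have "(V, U) \<in> (A \<union> A\<inverse>)\<^sup>*" "(U, V) \<in> (A \<union> A\<inverse>)\<^sup>*"
    using \<open>T \<noteq> {}\<close> by (auto simp: A_def two_vertex_graph_def image_constant_conv)
  moreover have "verts (two_vertex_graph L) = {V, U}"
    by (simp add: two_vertex_graph_def)
  ultimately show "connected_by (two_vertex_graph L) T"
    unfolding connected_by_def Let_def A_def[symmetric] by simp
qed

lemma labeled_graph_two_vertex_graph:
  assumes "L \<noteq> []" "\<And>x y. (x, y) \<in> set L \<Longrightarrow> x \<noteq> 0 \<and> y \<noteq> 0"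
  shows "labeled_graph (two_vertex_graph L)"
proof -
  have "fst (L ! i) \<noteq> 0 \<and> snd (L ! i) \<noteq> 0" if "i < length L" for i
    using assms(2)[of "fst (L ! i)" "snd (L ! i)"] that by simp
  then show ?thesis
    using assms(1) unfolding labeled_graph_def connected_by_two_vertex_graph
    by (auto simp: two_vertex_graph_def)
qed

lemma spanning_tree_two_vertex_graph:
  assumes "i < length L"
  shows "spanning_tree (two_vertex_graph L) {i}"
  using assms unfolding spanning_tree_def connected_by_two_vertex_graph
  by (auto simp: two_vertex_graph_def)

lemma group_G1:
  assumes "k > 0" "n > 0"
  shows "group (G1 k n)"
proof -
  have "labeled_graph (graph1 k n)"
    unfolding graph1_def by (rule labeled_graph_two_vertex_graph) (use assms in auto)
  moreover have "spanning_tree (graph1 k n) {0}"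
    unfolding graph1_def by (rule spanning_tree_two_vertex_graph) simp
  ultimately show ?thesis
    unfolding G1_def by (rule group_gog_group)
qed

lemma group_G3:
  assumes "k > 0" "n > 0" "p > 0"
  shows "group (G3 k n p)"
proof -
  have "labeled_graph (graph3 k n p)"
    unfolding graph3_def by (rule labeled_graph_two_vertex_graph) (use assms in auto)
  moreover have "spanning_tree (graph3 k n p) {0}"
    unfolding graph3_def by (rule spanning_tree_two_vertex_graph) simp
  ultimately show ?thesis
    unfolding G3_def by (rule group_gog_group)
qed

end

theory Submission
  imports Defs
begin

text \<open>
  Both groups act on their Bass--Serre trees with infinite cyclic stabilisers. Let \<open>a\<close> generate the
  stabiliser of a vertex. If \<open>g\<close> conjugates some power \<open>a\<^sup>f\<close> to \<open>a\<^sup>m\<^sup>f\<close> with \<open>m > 1\<close>, the exponents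
  \<open>f\<close> for which the conjugate of \<open>a\<^sup>f\<close> lies in \<open>\<langle>a\<rangle>\<close> form a subgroup \<open>d\<int>\<close>, and the depth \<open>d\<close> does not
  change when \<open>g\<close> is replaced by a power. Replacing \<open>a\<close> by \<open>a\<^sup>r\<close> replaces \<open>d\<close> by \<open>d / gcd(d, r)\<close>, so up
  to this operation the set of depths is a commensurability invariant, once one knows that an
  isomorphism of finite-index subgroups maps a power of \<open>a\<close> to a power of \<open>a'\<close>. This holds
  because \<open>a\<close> has a power conjugate to a proper power of itself, whereas the powers of a hyperbolic
  element have linearly growing translation length.

  All depths of \<open>G\<^sub>1\<close> have the form \<open>k n\<^sup>j\<close>. In \<open>G\<^sub>3\<close> the depths \<open>n\<^sup>2\<^sup>i\<^sup>+\<^sup>1\<close> and \<open>p n\<^sup>2\<^sup>i\<close> occur for all \<open>i\<close>.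
  Their ratio \<open>n / p\<close> lies strictly between \<open>1\<close> and \<open>n\<close> and survives the operation for large \<open>i\<close>.
\<close>

section \<open>Normal forms\<close>

text \<open>
  \<open>St r\<^sub>1 i\<^sub>1 (St r\<^sub>2 i\<^sub>2 (\<dots> (Pt c)))\<close> stands for \<open>a\<^sup>r\<^sup>1 t\<^sub>1 b\<^sup>r\<^sup>2 t\<^sub>2\<inverse> \<dots> a\<^sup>c\<close>, where the path crosses the edges
  \<open>i\<^sub>1, i\<^sub>2, \<dots>\<close> alternately from \<open>V\<close> to \<open>U\<close> and back. Throughout, \<open>True\<close> denotes the vertex \<open>V\<close> and
  \<open>False\<close> the vertex \<open>U\<close>.
\<close>

datatype nform = Pt int | St int nat nform

primrec starts :: "nat \<Rightarrow> nform \<Rightarrow> bool" where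
  "starts i (Pt c) \<longleftrightarrow> False"
| "starts i (St r j w) \<longleftrightarrow> r = 0 \<and> j = i"

text \<open>Left multiplication by the letter of edge \<open>i\<close>, cancelling an immediate
  backtrack. One function serves both orientations, since crossing an edge twice is the
  identity.\<close>

primrec push :: "nat \<Rightarrow> nform \<Rightarrow> nform" where
  "push i (Pt c) = St 0 i (Pt c)"
| "push i (St r j w) = (if r = 0 \<and> j = i then w else St 0 i (St r j w))"

primrec shift :: "int \<Rightarrow> nform \<Rightarrow> nform" where
  "shift e (Pt c) = Pt (c + e)"
| "shift e (St r i w) = St r i (shift e w)"

text \<open>As \<open>shift\<close> is right multiplication by a power of \<open>a\<close>, a
  \<open>base\<close> stands for a coset of the vertex group at \<open>V\<close>, that is, for a
  vertex of the Bass--Serre tree.\<close>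

primrec base :: "nform \<Rightarrow> nform" where
  "base (Pt c) = Pt 0"
| "base (St r i w) = St r i (base w)"

primrec endpoint :: "nform \<Rightarrow> int" where
  "endpoint (Pt c) = c"
| "endpoint (St r i w) = endpoint w"

primrec path :: "nform \<Rightarrow> nat list" where
  "path (Pt c) = []"
| "path (St r i w) = i # path w"

text \<open>Final exponents are ignored, so this is the Gromov product of two tree vertices seen
  from the base vertex.\<close>

primrec lcp :: "nform \<Rightarrow> nform \<Rightarrow> nat" where
  "lcp (Pt c) x = 0"
| "lcp (St r i w) x = (case x of Pt c \<Rightarrow> 0 | St r' i' x' \<Rightarrow> if r = r' \<and> i = i' then Suc (lcp w x') else 0)"

abbreviation walk :: "nat list \<Rightarrow> nform" where
  "walk is \<equiv> foldr (St 0) is (Pt 0)"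

lemma starts_iff: "starts i w \<longleftrightarrow> (\<exists>w'. w = St 0 i w')"
  by (cases w) auto

lemma push_not_starts: "\<not> starts i w \<Longrightarrow> push i w = St 0 i w"
  by (cases w) auto

lemma shift_base: "shift (endpoint w) (base w) = w"
  by (induction w) auto

lemma shift_add: "shift e (shift e' w) = shift (e' + e) w"
  by (induction w) auto

lemma lcp_ultrametric: "min (lcp x y) (lcp y z) \<le> lcp x z"
proof (induction x arbitrary: y z)
  case (St r i w)
  show ?case
  proof (cases y)
    case y: (St r' i' y')
    show ?thesis
    proof (cases z)
      case (St r'' i'' z')
      then show ?thesis using y St.IH[of y' z'] by auto
    qed (use y in auto)
  qed auto
qed auto

section \<open>Arithmetic of reduced forms\<close>

locale edge_labels =
  fixes lam :: "bool \<Rightarrow> nat \<Rightarrow> int" and m :: nat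
  assumes lam_pos: "i < m \<Longrightarrow> lam v i > 0"
begin

text \<open>Normal forms end at \<open>V\<close>, so those starting at \<open>V\<close> cross an even number of edges.\<close>

primrec valid :: "bool \<Rightarrow> nform \<Rightarrow> bool" where
  "valid v (Pt c) \<longleftrightarrow> v"
| "valid v (St r i w) \<longleftrightarrow> i < m \<and> 0 \<le> r \<and> r < lam v i \<and> valid (\<not> v) w \<and> \<not> starts i w"

text \<open>Left multiplication by the \<open>z\<close>-th power of the generator at \<open>v\<close>, pushing the carry across the edges.\<close>

primrec add :: "bool \<Rightarrow> int \<Rightarrow> nform \<Rightarrow> nform" where
  "add v z (Pt c) = Pt (c + z)"
| "add v z (St r i w) =
    St ((r + z) mod lam v i) i (add (\<not> v) ((r + z) div lam v i * lam (\<not> v) i) w)"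

text \<open>The power \<open>f\<close> of the generator at \<open>v\<close> fixes the whole path and equals the power \<open>e\<close> of the
  generator at its end.\<close>

primrec transports :: "bool \<Rightarrow> nat list \<Rightarrow> int \<Rightarrow> int \<Rightarrow> bool" where
  "transports v [] f e \<longleftrightarrow> f = e"
| "transports v (i # is) f e \<longleftrightarrow>
    (\<exists>q. f = q * lam v i \<and> transports (\<not> v) is (q * lam (\<not> v) i) e)"

text \<open>The normal form of \<open>w\<inverse> x\<close>.\<close>

primrec unwind :: "bool \<Rightarrow> nform \<Rightarrow> nform \<Rightarrow> nform" where
  "unwind v (Pt c) x = add v (- c) x"
| "unwind v (St r i w) x = unwind (\<not> v) w (push i (add v (- r) x))"

lemma add_0: "valid v w \<Longrightarrow> add v 0 w = w"
  by (induction w arbitrary: v) auto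

lemma add_add: "valid v w \<Longrightarrow> add v z (add v z' w) = add v (z + z') w"
proof (induction w arbitrary: v z z')
  case (St r i w)
  let ?l = "lam v i" and ?q = "(r + z') div lam v i"
  have l: "?l > 0" using St.prems lam_pos by auto
  have m: "((r + z') mod ?l + z) mod ?l = (r + (z + z')) mod ?l"
    by (simp add: mod_simps algebra_simps)
  have "r + (z + z') = ((r + z') mod ?l + z) + ?q * ?l"
    by (simp add: algebra_simps)
  then have "(r + (z + z')) div ?l = (((r + z') mod ?l + z) + ?q * ?l) div ?l"
    by (rule arg_cong)
  then have d: "(r + (z + z')) div ?l = ?q + ((r + z') mod ?l + z) div ?l"
    using l div_mult_self1[of ?l "(r + z') mod ?l + z" ?q] by linarith
  show ?case
    using St.prems m d by (simp add: St.IH distrib_right add.commute)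
qed simp

text \<open>Only a first step across \<open>i\<close> itself matters, and its residue modulo
  \<open>lam v i\<close> is unchanged. Carries arriving across \<open>i\<close> are such multiples,
  so \<open>add\<close> never creates a backtrack.\<close>

lemma starts_add: "valid v w \<Longrightarrow> starts i (add v (q * lam v i) w) = starts i w"
  using lam_pos by (cases w) (auto dest: zdvd_not_zless simp: order_le_less)

lemma valid_add: "valid v w \<Longrightarrow> valid v (add v z w)"
  by (induction w arbitrary: v z) (use lam_pos starts_add in auto)

lemma valid_push: "valid (\<not> v) w \<Longrightarrow> i < m \<Longrightarrow> valid v (push i w)"
  using lam_pos by (cases w) auto

lemma push_push: "valid v w \<Longrightarrow> push i (push i w) = w"
  using push_not_starts by (cases w) auto

text \<open>This is the defining relation of edge \<open>i\<close> read on forms; later it makes the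
  relators act trivially.\<close>

lemma push_add:
  assumes "valid (\<not> v) w" "i < m"
  shows "push i (add (\<not> v) (q * lam (\<not> v) i) w) = add v (q * lam v i) (push i w)"
proof (cases "starts i w")
  case True
  then obtain w' where w: "w = St 0 i w'" by (auto simp: starts_iff)
  then show ?thesis using lam_pos[OF assms(2), of "\<not> v"] by simp
next
  case False
  then have "\<not> starts i (add (\<not> v) (q * lam (\<not> v) i) w)"
    using starts_add assms by blast
  with False show ?thesis
    using lam_pos[OF assms(2), of v] by (simp add: push_not_starts)
qed

text \<open>Equality leaves every residue along the path unchanged, so at each edge the incoming
  exponent is an exact multiple of the label. The residues drop out and only the edge sequence
  matters.\<close>

lemma add_eq_shift_iff:
  "valid v w \<Longrightarrow> add v f w = shift e w \<longleftrightarrow> transports v (path w) f e"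
proof (induction w arbitrary: v f)
  case (St r i w)
  let ?l = "lam v i"
  have r: "0 \<le> r" "r < ?l" using St.prems by auto
  have "(r + f) mod ?l = r \<and> add (\<not> v) ((r + f) div ?l * lam (\<not> v) i) w = shift e w \<longleftrightarrow>
      (\<exists>q. f = q * ?l \<and> add (\<not> v) (q * lam (\<not> v) i) w = shift e w)"
  proof
    assume *: "(r + f) mod ?l = r \<and> add (\<not> v) ((r + f) div ?l * lam (\<not> v) i) w = shift e w"
    then have "f = (r + f) div ?l * ?l"
      using div_mult_mod_eq[of "r + f" ?l] by linarith
    with * show "\<exists>q. f = q * ?l \<and> add (\<not> v) (q * lam (\<not> v) i) w = shift e w" by blast
  qed (use r in auto)
  then show ?case using St by auto
qed auto

lemma valid_shift [simp]: "valid v (shift e w) \<longleftrightarrow> valid v w"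
proof (induction w arbitrary: v)
  case (St r i w)
  have "starts i (shift e w) = starts i w" by (cases w) auto
  then show ?case using St by auto
qed auto

lemma valid_base [simp]: "valid v (base w) \<longleftrightarrow> valid v w"
  by (metis shift_base valid_shift)

lemma path_add [simp]: "path (add v z w) = path w"
  by (induction w arbitrary: v z) auto

lemma valid_unwind: "valid v w \<Longrightarrow> valid v x \<Longrightarrow> valid True (unwind v w x)"
proof (induction w arbitrary: v x)
  case (St r i w)
  have "valid (\<not> v) (push i (add v (- r) x))"
    using St.prems by (intro valid_push) (auto intro: valid_add)
  then show ?case using St by simp
qed (simp add: valid_add)

text \<open>As long as \<open>w\<close> and \<open>x\<close> agree, each step of \<open>w\<close>
  removes one of \<open>x\<close>; from the first disagreement on, each adds one.\<close>

lemma length_unwind: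
  "valid v w \<Longrightarrow> valid v x \<Longrightarrow>
    length (path (unwind v w x)) + 2 * lcp w x = length (path w) + length (path x)"
proof (induction w arbitrary: v x)
  case (St r i w)
  show ?case
  proof (cases "\<exists>x'. x = St r i x'")
    case True
    then obtain x' where x: "x = St r i x'" by blast
    then show ?thesis
      using St.prems St.IH[of "\<not> v" x'] by (simp add: add_0)
  next
    case False
    have i: "i < m" using St.prems by simp
    have "\<not> starts i (add v (- r) x)"
    proof
      assume *: "starts i (add v (- r) x)"
      then obtain r' x' where x: "x = St r' i x'" "(r' - r) mod lam v i = 0"
        by (cases x) auto
      have "0 \<le> r'" "r' < lam v i" "0 \<le> r" "r < lam v i" using St.prems x by auto
      then have "r' = r"
        using x(2) by (metis mod_eq_dvd_iff mod_eq_0_iff_dvd mod_pos_pos_trivial)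
      with x False show False by simp
    qed
    then have p: "push i (add v (- r) x) = St 0 i (add v (- r) x)"
      by (rule push_not_starts)
    have "valid (\<not> v) (push i (add v (- r) x))"
      using St.prems i by (auto intro!: valid_add valid_push)
    \<comment> \<open>Reducedness forbids \<open>w\<close> to begin with the step just prepended, so
      nothing cancels during the rest of \<open>w\<close>.\<close>
    moreover have "lcp w (St 0 i (add v (- r) x)) = 0"
      using St.prems by (cases w) auto
    moreover have "lcp (St r i w) x = 0"
      using False by (cases x) auto
    ultimately show ?thesis
      using St.IH[of "\<not> v" "push i (add v (- r) x)"] St.prems p by simp
  qed
qed auto

text \<open>Local finiteness of the tree: each step has finitely many edges and residues to choose
  from.\<close>

lemma finite_forms: "finite {w. valid v w \<and> length (path w) \<le> B \<and> endpoint w = 0}"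
proof (induction B arbitrary: v)
  case 0
  have "{w. valid v w \<and> length (path w) \<le> 0 \<and> endpoint w = 0} \<subseteq> {Pt 0}"
  proof
    fix w assume "w \<in> {w. valid v w \<and> length (path w) \<le> 0 \<and> endpoint w = 0}"
    then show "w \<in> {Pt 0}" by (cases w) auto
  qed
  then show ?case by (rule finite_subset) simp
next
  case (Suc B)
  let ?F = "\<lambda>v B. {w. valid v w \<and> length (path w) \<le> B \<and> endpoint w = 0}"
  have "?F v (Suc B) \<subseteq> insert (Pt 0) (\<Union>i<m. \<Union>r\<in>{0..<lam v i}. St r i ` ?F (\<not> v) B)"
  proof
    fix w assume "w \<in> ?F v (Suc B)"
    then show "w \<in> insert (Pt 0) (\<Union>i<m. \<Union>r\<in>{0..<lam v i}. St r i ` ?F (\<not> v) B)"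
      by (cases w) (auto intro!: bexI imageI)
  qed
  moreover have "finite (\<Union>i<m. \<Union>r\<in>{0..<lam v i}. St r i ` ?F (\<not> v) B)"
    using Suc by simp
  ultimately show ?case by (meson finite_insert finite_subset)
qed

end

section \<open>Normal forms in a group\<close>

context group begin

lemma conj_int_pow:
  assumes "x \<in> carrier G" "t \<in> carrier G"
  shows "(t \<otimes> x \<otimes> inv t) [^] (z::int) = t \<otimes> x [^] z \<otimes> inv t"
proof -
  have "(\<lambda>x. t \<otimes> x \<otimes> inv t) \<in> hom G G"
    using assms(2) by (auto intro!: homI simp: m_assoc inv_solve_left)
  then have "group_hom G G (\<lambda>x. t \<otimes> x \<otimes> inv t)"
    by (simp add: group_hom_def group_hom_axioms_def group_axioms)
  from group_hom.hom_int_pow[OF this assms(1)] show ?thesis by simp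
qed

lemma int_pow_commute_conj:
  assumes "x \<in> carrier G" "y \<in> carrier G" "t \<in> carrier G" "x \<otimes> t = t \<otimes> y"
  shows "x [^] (z::int) \<otimes> t = t \<otimes> y [^] z"
proof -
  have "x = t \<otimes> y \<otimes> inv t"
    using assms by (metis inv_solve_right m_closed)
  then show ?thesis
    using assms conj_int_pow[of y t z] by (simp add: m_assoc)
qed

lemma conj_nat_pow_iterate:
  assumes x: "x \<in> carrier G" and y: "y \<in> carrier G" and yx: "y \<otimes> x \<otimes> inv y = x [^] (N::nat)"
  shows "x [^] (N ^ s) = y [^] s \<otimes> x \<otimes> inv (y [^] (s::nat))"
proof (induction s)
  case 0
  then show ?case using x by simp
next
  case (Suc s)
  have "x [^] (N ^ Suc s) = (x [^] N) [^] (N ^ s)"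
    using x by (simp add: nat_pow_pow)
  also have "\<dots> = (y \<otimes> x \<otimes> inv y) [^] (int (N ^ s))"
    by (simp only: yx int_pow_int)
  also have "\<dots> = y \<otimes> x [^] (N ^ s) \<otimes> inv y"
    by (subst conj_int_pow[OF x y]) (simp only: int_pow_int)
  also have "\<dots> = y [^] Suc s \<otimes> x \<otimes> inv (y [^] Suc s)"
    unfolding Suc nat_pow_Suc2[OF y] using x y by (simp add: inv_mult_group m_assoc)
  finally show ?case .
qed

end

section \<open>Evaluation of forms in a group satisfying the edge relations\<close>

locale labeled_generators = group G + edge_labels lam m for G (structure) and lam m +
  fixes A :: "bool \<Rightarrow> 'a" and T :: "bool \<Rightarrow> nat \<Rightarrow> 'a"
  assumes A_closed [simp]: "A v \<in> carrier G"
    and T_closed [simp]: "i < m \<Longrightarrow> T v i \<in> carrier G"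
    and T_not: "i < m \<Longrightarrow> T v i \<otimes> T (\<not> v) i = \<one>"
    and edge_relation: "i < m \<Longrightarrow> A v [^] lam v i \<otimes> T v i = T v i \<otimes> A (\<not> v) [^] lam (\<not> v) i"
begin

text \<open>So \<open>inv g\<close> conjugates the power \<open>f\<close> of \<open>a\<close> to the
  power \<open>e\<close>. The exponents \<open>f\<close> admitting some \<open>e\<close> form the
  subgroup generated by the depth.\<close>

definition carries :: "'a \<Rightarrow> int \<Rightarrow> int \<Rightarrow> bool" where
  "carries g f e \<longleftrightarrow> A True [^] f \<otimes> g = g \<otimes> A True [^] e"

primrec ev :: "bool \<Rightarrow> nform \<Rightarrow> 'a" where
  "ev v (Pt c) = A v [^] c"
| "ev v (St r i w) = A v [^] r \<otimes> (T v i \<otimes> ev (\<not> v) w)"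

lemma ev_closed [simp]: "valid v w \<Longrightarrow> ev v w \<in> carrier G"
  by (induction w arbitrary: v) auto

lemma edge_relation_pow:
  "i < m \<Longrightarrow> A v [^] (q * lam v i) \<otimes> T v i = T v i \<otimes> A (\<not> v) [^] (q * lam (\<not> v) i)"
  using int_pow_commute_conj[OF _ _ _ edge_relation[of i v], where z = q]
  by (simp add: int_pow_pow mult.commute)

lemma ev_add: "valid v w \<Longrightarrow> ev v (add v z w) = A v [^] z \<otimes> ev v w"
proof (induction w arbitrary: v z)
  case (Pt c)
  then show ?case by (simp add: int_pow_mult[symmetric] add.commute)
next
  case (St r i w)
  let ?q = "(r + z) div lam v i"
  have i: "i < m" and w: "valid (\<not> v) w" using St.prems by auto
  have "ev v (add v z (St r i w)) =
      A v [^] ((r + z) mod lam v i) \<otimes> ((T v i \<otimes> A (\<not> v) [^] (?q * lam (\<not> v) i)) \<otimes> ev (\<not> v) w)"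
    using i w by (simp add: St.IH m_assoc)
  also have "\<dots> = (A v [^] ((r + z) mod lam v i) \<otimes> A v [^] (?q * lam v i)) \<otimes> (T v i \<otimes> ev (\<not> v) w)"
    using i w by (simp add: edge_relation_pow[symmetric] m_assoc)
  also have "\<dots> = A v [^] (z + r) \<otimes> (T v i \<otimes> ev (\<not> v) w)"
    by (simp add: int_pow_mult[symmetric] add.commute)
  finally show ?case
    using i w by (simp add: int_pow_mult m_assoc)
qed

lemma ev_push: "valid (\<not> v) w \<Longrightarrow> i < m \<Longrightarrow> ev v (push i w) = T v i \<otimes> ev (\<not> v) w"
proof (cases "starts i w")
  case True
  assume "valid (\<not> v) w" "i < m"
  with True show ?thesis
    by (auto simp: starts_iff m_assoc[symmetric] T_not)
next
  case False
  assume "valid (\<not> v) w" "i < m"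
  with False show ?thesis by (simp add: push_not_starts)
qed

lemma ev_shift: "valid v w \<Longrightarrow> ev v (shift e w) = ev v w \<otimes> A True [^] e"
  by (induction w arbitrary: v) (auto simp: int_pow_mult m_assoc)

lemma inv_T: "i < m \<Longrightarrow> inv (T v i) = T (\<not> v) i"
  using T_not[of i "\<not> v"] by (simp add: inv_equality)

lemma ev_unwind:
  "valid v w \<Longrightarrow> valid v x \<Longrightarrow> ev True (unwind v w x) = inv (ev v w) \<otimes> ev v x"
proof (induction w arbitrary: v x)
  case (Pt c)
  then show ?case by (simp add: ev_add int_pow_neg)
next
  case (St r i w)
  have i: "i < m" and w: "valid (\<not> v) w" using St.prems by auto
  have 1: "valid v (add v (- r) x)" using St.prems by (simp add: valid_add)
  then have 2: "valid (\<not> v) (push i (add v (- r) x))" using i by (intro valid_push) auto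
  show ?case
    using St.prems i w St.IH[OF w 2] ev_push[of "\<not> v" "add v (- r) x" i] 1
    by (simp add: ev_add int_pow_neg inv_mult_group inv_T m_assoc)
qed

lemma valid_walk:
  "set is \<subseteq> {..<m} \<Longrightarrow> even (length is) = v \<Longrightarrow> distinct_adj is \<Longrightarrow> valid v (walk is)"
proof (induction "is" arbitrary: v)
  case (Cons i "is")
  have "\<not> starts i (walk is)"
    using Cons.prems by (cases "is") auto
  moreover have "distinct_adj is" using Cons.prems by (cases "is") auto
  ultimately show ?case using Cons lam_pos[of i v] by auto
qed auto

lemma ev_walk_append:
  assumes "set is \<subseteq> {..<m}" "set js \<subseteq> {..<m}"
  shows "ev v (walk (is @ js)) =
    ev v (walk is) \<otimes> ev (if even (length is) then v else \<not> v) (walk js)"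
proof -
  have cl: "set js \<subseteq> {..<m} \<Longrightarrow> ev v (walk js) \<in> carrier G" for v js
    by (induction js arbitrary: v) auto
  show ?thesis
    using assms by (induction "is" arbitrary: v) (auto simp: cl m_assoc)
qed

end

text \<open>The two assumptions are the uniqueness and existence parts of the normal form theorem
  for graphs of groups; they are proved below for positive two-vertex graphs.\<close>

locale normal_forms = labeled_generators +
  assumes inj_ev: "valid True w \<Longrightarrow> valid True w' \<Longrightarrow> ev True w = ev True w' \<Longrightarrow> w = w'"
    and surj_ev: "g \<in> carrier G \<Longrightarrow> \<exists>w. valid True w \<and> ev True w = g"
begin

definition nf :: "'a \<Rightarrow> nform" where
  "nf g = (THE w. valid True w \<and> ev True w = g)"

lemma nf: "g \<in> carrier G \<Longrightarrow> valid True (nf g) \<and> ev True (nf g) = g"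
  unfolding nf_def by (rule theI') (use inj_ev surj_ev in blast)

lemma nf_ev: "valid True w \<Longrightarrow> nf (ev True w) = w"
  using nf inj_ev by simp

lemma A_pow_eq: "A True [^] (z::int) = A True [^] (z'::int) \<Longrightarrow> z = z'"
  using inj_ev[of "Pt z" "Pt z'"] by simp

lemma carries_ev_iff:
  assumes "valid True w"
  shows "carries (ev True w) f e \<longleftrightarrow> transports True (path w) f e"
proof -
  have "carries (ev True w) f e \<longleftrightarrow> ev True (add True f w) = ev True (shift e w)"
    using assms by (simp add: carries_def ev_add ev_shift)
  also have "\<dots> \<longleftrightarrow> add True f w = shift e w"
    using assms inj_ev valid_add valid_shift by metis
  finally show ?thesis using add_eq_shift_iff[OF assms] by simp
qed

section \<open>Displacement of the base vertex of the Bass--Serre tree\<close>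

definition len :: "'a \<Rightarrow> nat" where
  "len g = length (path (nf g))"

lemma len_inv_mult:
  assumes "g \<in> carrier G" "h \<in> carrier G"
  shows "len (inv g \<otimes> h) + 2 * lcp (nf g) (nf h) = len g + len h"
proof -
  have "nf (inv g \<otimes> h) = unwind True (nf g) (nf h)"
    using assms nf[of g] nf[of h] ev_unwind[of True "nf g" "nf h"] nf_ev valid_unwind by metis
  then show ?thesis
    using assms nf[of g] nf[of h] by (simp add: len_def length_unwind)
qed

lemma len_one: "len \<one> = 0"
  using nf_ev[of "Pt 0"] by (simp add: len_def)

lemma lcp_Pt: "lcp x (Pt c) = 0" by (cases x) auto

lemma len_inv: "g \<in> carrier G \<Longrightarrow> len (inv g) = len g"
  using len_inv_mult[of g \<one>] nf_ev[of "Pt 0"] by (simp add: len_one lcp_Pt)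

lemma len_mult: "g \<in> carrier G \<Longrightarrow> h \<in> carrier G \<Longrightarrow> len (g \<otimes> h) \<le> len g + len h"
  using len_inv_mult[of "inv g" h] by (simp add: len_inv)

lemma len_pow: "g \<in> carrier G \<Longrightarrow> len (g [^] (j::nat)) \<le> j * len g"
proof (induction j)
  case (Suc j)
  then show ?case using len_mult[of "g [^] j" g] by simp
qed (simp add: len_one)

text \<open>The four-point condition for the tree points \<open>1, x, x\<^sup>j\<^sup>+\<^sup>1, x\<^sup>j\<^sup>+\<^sup>2\<close>, with the common prefixes of
  normal forms as Gromov products.\<close>

lemma len_pow_convex:
  assumes x: "x \<in> carrier G" and gt: "len (x [^] Suc j) > len x"
  shows "2 * len (x [^] Suc j) \<le> len (x [^] Suc (Suc j)) + len (x [^] j)"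
proof -
  let ?y = "x [^] Suc j" and ?z = "x [^] Suc (Suc j)"
  have c: "x [^] l \<in> carrier G" for l :: nat using x by simp
  have 1: "inv x \<otimes> ?y = x [^] j"
    using x nat_pow_Suc2[of x j] by (simp add: m_assoc[symmetric] del: nat_pow_Suc)
  have 2: "inv x \<otimes> ?z = ?y"
    using x nat_pow_Suc2[of x "Suc j"] by (simp add: m_assoc[symmetric] del: nat_pow_Suc)
  have 3: "inv ?y \<otimes> ?z = x"
    using inv_solve_left[of x ?y ?z] x by simp
  \<comment> \<open>If the overlap of \<open>?y\<close> and \<open>?z\<close> realised the minimum,
    the length formulas would give \<open>len (x [^] Suc j) \<le> len x\<close>, against
    \<open>gt\<close>. The other alternative is convexity.\<close>
  show ?thesis
    using len_inv_mult[OF x c[of "Suc j"], unfolded 1]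
      len_inv_mult[OF x c[of "Suc (Suc j)"], unfolded 2]
      len_inv_mult[OF c c, of "Suc j" "Suc (Suc j)", unfolded 3]
      lcp_ultrametric[of "nf x" "nf ?y" "nf ?z"] gt
    by (simp add: min_def split: if_splits)
qed

text \<open>At the first power longer than \<open>x\<close> the length has just increased. By
  convexity later increments are no smaller, so the length grows by at least one per step.\<close>

lemma len_pow_linear:
  assumes x: "x \<in> carrier G" and gt: "len (x [^] Suc j) > len x"
  shows "\<exists>j. \<forall>s. len (x [^] (j + s)) \<ge> s"
proof -
  define j0 where "j0 = (LEAST j. len (x [^] Suc j) > len x)"
  have j0: "len (x [^] Suc j0) > len x"
    unfolding j0_def by (rule LeastI, rule gt)
  have min: "len (x [^] Suc j) \<le> len x" if "j < j0" for j
    using that not_less_Least unfolding j0_def by fastforce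
  have "len (x [^] j0) \<le> len x"
  proof (cases j0)
    case 0 then show ?thesis by (simp add: len_one)
  next
    case (Suc j) then show ?thesis using min[of j] by simp
  qed
  with j0 have base: "len (x [^] Suc j0) > len (x [^] j0)" by simp
  have step: "len (x [^] Suc (j0 + s)) > len (x [^] (j0 + s)) \<and> len (x [^] Suc (j0 + s)) > len x \<and>
      len (x [^] (j0 + s)) \<ge> s" for s
  proof (induction s)
    case 0
    then show ?case using base j0 by simp
  next
    case (Suc s)
    then show ?case using len_pow_convex[OF x, of "j0 + s"] by (simp del: nat_pow_Suc)
  qed
  then show ?thesis by blast
qed

text \<open>Up to the final exponent only finitely many normal forms have bounded length, so two powers of
  \<open>x\<close> differ by a power of the vertex generator.\<close>

lemma bounded_power_elliptic:
  assumes x: "x \<in> carrier G" and le: "\<And>j. len (x [^] Suc j) \<le> len x"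
  shows "\<exists>M>0. \<exists>s::int. x [^] (M::nat) = A True [^] s"
proof -
  let ?F = "{w. valid True w \<and> length (path w) \<le> len x \<and> endpoint w = 0}"
  have pb: "path (base w) = path w" "endpoint (base w) = 0" for w
    by (induction w) auto
  have c: "x [^] l \<in> carrier G" for l :: nat using x by simp
  have "base (nf (x [^] Suc j)) \<in> ?F" for j
    using nf[OF c, of "Suc j"] le[of j] unfolding len_def by (simp only: mem_Collect_eq valid_base pb simp_thms)
  then have "(\<lambda>j. base (nf (x [^] Suc j))) ` UNIV \<subseteq> ?F"
    by (rule image_subsetI)
  then have "finite (range (\<lambda>j. base (nf (x [^] Suc j))))"
    using finite_forms by (rule finite_subset)
  then have "\<not> inj (\<lambda>j. base (nf (x [^] Suc j)))"
    using finite_imageD infinite_UNIV_nat by blast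
  then obtain i j where ij: "i \<noteq> j" "base (nf (x [^] Suc i)) = base (nf (x [^] Suc j))"
    unfolding inj_def by blast
  have "\<exists>i j. i < j \<and> base (nf (x [^] Suc i)) = base (nf (x [^] Suc j))"
    using ij by (metis linorder_neqE_nat)
  then obtain i j where ij: "i < j" "base (nf (x [^] Suc i)) = base (nf (x [^] Suc j))"
    by blast
  let ?w = "nf (x [^] Suc i)" and ?w' = "nf (x [^] Suc j)"
  have "?w' = shift (endpoint ?w' - endpoint ?w) ?w"
    using ij(2) shift_base[of ?w] shift_base[of ?w'] shift_add by (metis add.commute diff_add_cancel)
  then obtain e where "?w' = shift e ?w" by blast
  then have "x [^] Suc j = x [^] Suc i \<otimes> A True [^] e"
    using nf[OF c[of "Suc i"]] nf[OF c[of "Suc j"]] ev_shift by metis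
  moreover have "x [^] Suc j = x [^] Suc i \<otimes> x [^] (j - i)"
    using nat_pow_mult[OF x, of "Suc i" "j - i"] ij(1) by (simp only: add_Suc le_add_diff_inverse less_imp_le_nat)
  ultimately have "x [^] (j - i) = A True [^] e"
    using x by (metis A_closed c int_pow_closed Units_l_cancel Units_eq)
  with ij(1) show ?thesis by (intro exI[of _ "j - i"]) auto
qed

text \<open>If some power were longer than \<open>x\<close>, lengths would grow linearly along the
  powers of \<open>x\<close>. But the power \<open>N ^ s\<close> is a conjugate by
  \<open>y [^] s\<close>, hence of length at most linear in \<open>s\<close>.\<close>

lemma distorted_elliptic:
  fixes N :: nat
  assumes x: "x \<in> carrier G" and y: "y \<in> carrier G" and N: "N \<ge> 2"
    and yx: "y \<otimes> x \<otimes> inv y = x [^] N"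
  shows "\<exists>M>0. \<exists>s::int. x [^] (M::nat) = A True [^] s"
proof (rule bounded_power_elliptic[OF x], rule ccontr)
  fix j assume "\<not> len (x [^] Suc j) \<le> len x"
  then obtain j where lin: "\<And>s. len (x [^] (j + s)) \<ge> s"
    using len_pow_linear[OF x] by (meson not_le)
  note conj = conj_nat_pow_iterate[OF x y yx]
  have "N ^ s \<le> j + len x + 2 * len y * s" for s
  proof -
    have "len (x [^] (N ^ s)) \<le> len (y [^] s) + len x + len (y [^] s)"
      unfolding conj using x y len_mult[of "y [^] s \<otimes> x" "inv (y [^] s)"] len_mult[of "y [^] s" x]
      by (simp add: len_inv)
    also have "\<dots> \<le> len x + 2 * len y * s"
      using len_pow[OF y, of s] by (simp add: algebra_simps)
    finally show ?thesis
      using lin[of "N ^ s - j"] by (cases "N ^ s \<ge> j") auto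
  qed
  moreover have "2 ^ s \<le> N ^ s" for s using N by (rule power_mono) simp
  ultimately have "2 ^ s \<le> j + len x + 2 * len y * s" for s
    using le_trans by blast
  then have bound: "2 ^ s \<le> (j + len x) + 2 * len y * s" for s .
  \<comment> \<open>At \<open>s = 6 * D\<close> the bound yields
    \<open>9 * D * D \<le> D + 6 * D * D\<close>, which fails for positive \<open>D\<close>.\<close>
  define D where "D = j + len x + 2 * len y + 1"
  have "2 ^ (2 * t) \<ge> t * t" for t :: nat
    using less_exp[of t] by (simp add: power_mult power2_eq_square mult_2 power_add mult_le_mono less_imp_le)
  then have "(3 * D) * (3 * D) \<le> (2::nat) ^ (2 * (3 * D))" .
  also have "\<dots> \<le> (j + len x) + 2 * len y * (2 * (3 * D))"
    by (rule bound)
  also have "\<dots> \<le> D + D * (2 * (3 * D))"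
    by (intro add_mono mult_le_mono1) (simp_all add: D_def)
  finally have "D * (9 * D) \<le> D * (1 + 6 * D)"
    by (simp add: algebra_simps)
  moreover have "D > 0"
    by (simp add: D_def)
  ultimately show False
    by simp
qed

text \<open>The edge path is cyclically reduced: \<open>last is \<noteq> hd is\<close> excludes a
  backtrack where two copies of \<open>is\<close> meet, so the power has the concatenated walk as
  its normal form.\<close>

lemma carries_power_iff:
  assumes "set is \<subseteq> {..<m}" "even (length is)" "distinct_adj is" "is \<noteq> []" "last is \<noteq> hd is"
  shows "carries (ev True (walk is) [^] (M::nat)) f e \<longleftrightarrow>
    transports True (concat (replicate M is)) f e"
proof -
  let ?js = "\<lambda>M. concat (replicate M is)"
  let ?w = "\<lambda>M. walk (?js M)"
  have pw: "path (walk js) = js" for js by (induction js) auto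
  have s: "set (?js M) \<subseteq> {..<m}" for M using assms(1) by (induction M) auto
  have e: "even (length (?js M))" for M using assms(2) by (induction M) auto
  have h: "M > 0 \<Longrightarrow> hd (?js M) = hd is" for M
    using assms(4) by (cases M) auto
  have d: "distinct_adj (?js M)" for M
  proof (induction M)
    case (Suc M)
    then show ?case
      using assms(3,4,5) h[of M] by (cases M) (auto simp: distinct_adj_append_iff)
  qed simp
  have "ev True (?w M) = ev True (walk is) [^] M" for M
  proof (induction M)
    case (Suc M)
    have "valid True (walk is)" using assms by (intro valid_walk) auto
    then show ?case
      using ev_walk_append[OF assms(1) s[of M], of True] Suc assms(2) nat_pow_Suc2
      by (simp del: nat_pow_Suc)
  qed simp
  moreover have "valid True (?w M)" using s e d by (intro valid_walk) auto
  ultimately show ?thesis using carries_ev_iff[of "?w M" f e] pw by simp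
qed

end

section \<open>The normal form theorem for two-vertex graphs\<close>

lemma word_inv_word_pow: "word_inv (word_pow x z) = word_pow x (- z)"
  by (cases "z = 0") (auto simp: word_inv_def word_pow_def)

text \<open>Induction runs away from zero on both sides, so each step prepends a letter of the sign
  already present and nothing cancels.\<close>

lemma word_pow_induct [case_names zero plus minus]:
  assumes "P (word_pow x 0) 0"
    and "\<And>z. z \<ge> 0 \<Longrightarrow> P (word_pow x z) z \<Longrightarrow> P ((x, True) # word_pow x z) (1 + z)"
    and "\<And>z. z \<le> 0 \<Longrightarrow> P (word_pow x z) z \<Longrightarrow> P ((x, False) # word_pow x z) (- 1 + z)"
  shows "P (word_pow x z) (z::int)"
proof (induction z rule: int_induct[where k = 0])
  case base
  show ?case by (rule assms(1))
next
  case (step1 z)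
  have "word_pow x (z + 1) = (x, True) # word_pow x z"
    using step1.hyps by (simp add: word_pow_def nat_add_distrib)
  then show ?case using assms(2)[OF step1] by (simp add: add.commute)
next
  case (step2 z)
  have "nat (1 - z) = Suc (nat (- z))"
    using step2.hyps by simp
  then have "word_pow x (z - 1) = (x, False) # word_pow x z"
    using step2.hyps by (cases "z = 0") (auto simp: word_pow_def)
  then show ?case using assms(3)[OF step2] by simp
qed

context
  fixes S :: "'g set" and R :: "'g word set"
  assumes R: "R \<subseteq> words S"
begin

lemma class_eq_iff:
  "w \<in> words S \<Longrightarrow> w' \<in> words S \<Longrightarrow>
    word_cong S R `` {w} = word_cong S R `` {w'} \<longleftrightarrow> (w, w') \<in> word_cong S R"
  using equiv_word_cong[OF R] by (simp add: eq_equiv_class_iff)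

lemma class_carrier: "w \<in> words S \<Longrightarrow> word_cong S R `` {w} \<in> carrier (presented_group S R)"
  by (auto simp: presented_group_def quotient_def)

lemma class_one: "\<one>\<^bsub>presented_group S R\<^esub> = word_cong S R `` {[]}"
  by (simp add: presented_group_def)

lemma class_inv:
  assumes "w \<in> words S"
  shows "inv\<^bsub>presented_group S R\<^esub> (word_cong S R `` {w}) = word_cong S R `` {word_inv w}"
proof -
  interpret group "presented_group S R" by (rule group_presented_group[OF R])
  show ?thesis
    using assms word_cong_word_inv[OF R assms]
    by (intro inv_equality) (auto simp: presented_group_mult[OF R] class_one class_eq_iff class_carrier)
qed

lemma class_word_pow:
  assumes "x \<in> S"
  shows "word_cong S R `` {word_pow x z} = (word_cong S R `` {[(x, True)]}) [^]\<^bsub>presented_group S R\<^esub> z"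
proof (induction rule: word_pow_induct)
  case zero
  then show ?case by (simp add: word_pow_def class_one)
next
  interpret group "presented_group S R" by (rule group_presented_group[OF R])
  have c: "word_cong S R `` {[(x, b)]} \<in> carrier (presented_group S R)" for b
    using assms by (intro class_carrier) simp
  {
    case (plus z)
    then show ?case
      using assms presented_group_mult[OF R, of "[(x, True)]" "word_pow x z"] c
      by (simp add: word_pow_in_words int_pow_mult)
  next
    case (minus z)
    have "word_cong S R `` {[(x, False)]} = word_cong S R `` {[(x, True)]} [^]\<^bsub>presented_group S R\<^esub> (- 1 :: int)"
      using assms class_inv[of "[(x, True)]"] c by (simp add: word_inv_def int_pow_neg)
    with minus show ?case
      using assms presented_group_mult[OF R, of "[(x, False)]" "word_pow x z"] c
      by (simp only: append_Cons append_Nil word_pow_in_words words_Cons words_Nil int_pow_mult simp_thms)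
  }
qed

end

section \<open>Groups of two-vertex graphs with positive labels\<close>

locale positive_two_vertex_graph =
  fixes L :: "(int \<times> int) list"
  assumes L_nonempty: "L \<noteq> []"
    and L_pos: "\<And>x y. (x, y) \<in> set L \<Longrightarrow> x > 0 \<and> y > 0"
begin

definition end_label :: "bool \<Rightarrow> nat \<Rightarrow> int" where
  "end_label v i = (if v then fst (L ! i) else snd (L ! i))"

definition vertex :: "bool \<Rightarrow> two_verts" where
  "vertex v = (if v then V else U)"

abbreviation gens :: "(two_verts, nat) gog_gen set" where
  "gens \<equiv> gog_gens (two_vertex_graph L)"

abbreviation rels :: "(two_verts, nat) gog_gen word set" where
  "rels \<equiv> gog_relators (two_vertex_graph L) {0}"

definition cls :: "(two_verts, nat) gog_gen word \<Rightarrow> (two_verts, nat) gog_gen word set" where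
  "cls w = word_cong gens rels `` {w}"

abbreviation G :: "(two_verts, nat) gog_gen word set monoid" where
  "G \<equiv> gog_group (two_vertex_graph L) {0}"

sublocale edge_labels end_label "length L"
proof
  fix i v assume "i < length L"
  then have "(fst (L ! i), snd (L ! i)) \<in> set L" by simp
  from L_pos[OF this] show "end_label v i > 0" by (simp add: end_label_def)
qed

lemma gens_iff [simp]: "Vertex_gen x \<in> gens" "Edge_gen i \<in> gens \<longleftrightarrow> i < length L"
  using two_verts.exhaust[of x] by (auto simp: gog_gens_def two_vertex_graph_def)

lemma edge_relator_eq:
  "edge_relator (two_vertex_graph L) i =
    [(Edge_gen i, True)] @ word_pow (Vertex_gen U) (end_label False i) @
    [(Edge_gen i, False)] @ word_pow (Vertex_gen V) (- end_label True i)"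
  by (simp add: edge_relator_def two_vertex_graph_def word_inv_word_pow end_label_def)

lemma rels_eq: "rels = edge_relator (two_vertex_graph L) ` {..<length L} \<union> {[(Edge_gen 0, True)]}"
  by (simp add: gog_relators_def) (simp add: two_vertex_graph_def)

lemma rels_words: "rels \<subseteq> words gens"
  using L_nonempty by (auto simp: rels_eq edge_relator_eq word_pow_in_words)

sublocale group G
  unfolding gog_group_def by (rule group_presented_group[OF rels_words])

lemma cls_mult: "w \<in> words gens \<Longrightarrow> w' \<in> words gens \<Longrightarrow> cls w \<otimes>\<^bsub>G\<^esub> cls w' = cls (w @ w')"
  by (simp add: cls_def gog_group_def presented_group_mult[OF rels_words])

lemma cls_eq_iff:
  "w \<in> words gens \<Longrightarrow> w' \<in> words gens \<Longrightarrow> cls w = cls w' \<longleftrightarrow> (w, w') \<in> word_cong gens rels"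
  unfolding cls_def by (rule class_eq_iff[OF rels_words])

lemma cls_closed [simp]: "w \<in> words gens \<Longrightarrow> cls w \<in> carrier G"
  unfolding cls_def gog_group_def by (rule class_carrier[OF rels_words])

lemma cls_one: "\<one>\<^bsub>G\<^esub> = cls []"
  by (simp add: cls_def gog_group_def class_one[OF rels_words])

lemma cls_pow: "x \<in> gens \<Longrightarrow> cls (word_pow x z) = cls [(x, True)] [^]\<^bsub>G\<^esub> z"
  by (simp add: cls_def gog_group_def class_word_pow[OF rels_words])

lemma cls_relator: "r \<in> rels \<Longrightarrow> cls r = \<one>\<^bsub>G\<^esub>"
  using word_cong.relator[of "[]" gens "[]" r rels] rels_words cls_eq_iff[of r "[]"]
  by (simp add: cls_one subset_iff)

definition A :: "bool \<Rightarrow> (two_verts, nat) gog_gen word set" where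
  "A v = cls [(Vertex_gen (vertex v), True)]"

definition T :: "bool \<Rightarrow> nat \<Rightarrow> (two_verts, nat) gog_gen word set" where
  "T v i = cls [(Edge_gen i, v)]"

lemma T_cancel: "i < length L \<Longrightarrow> T v i \<otimes>\<^bsub>G\<^esub> T (\<not> v) i = \<one>\<^bsub>G\<^esub>"
  using word_cong.cancel[of "[]" gens "[]" "Edge_gen i" v rels]
  by (simp add: T_def cls_mult cls_one cls_eq_iff)

lemma A_relation:
  assumes i: "i < length L"
  shows "T True i \<otimes>\<^bsub>G\<^esub> (A False [^]\<^bsub>G\<^esub> end_label False i \<otimes>\<^bsub>G\<^esub>
    (T False i \<otimes>\<^bsub>G\<^esub> A True [^]\<^bsub>G\<^esub> (- end_label True i))) = \<one>\<^bsub>G\<^esub>"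
proof -
  have "edge_relator (two_vertex_graph L) i \<in> rels"
    using i by (simp add: rels_eq)
  from cls_relator[OF this] show ?thesis
    using i by (simp add: edge_relator_eq A_def T_def cls_pow[symmetric] cls_mult word_pow_in_words vertex_def)
qed

sublocale labeled_generators G end_label "length L" A T
proof
  show A: "A v \<in> carrier G" for v by (simp add: A_def)
  show T: "T v i \<in> carrier G" if "i < length L" for v i using that by (simp add: T_def)
  show TT: "T v i \<otimes>\<^bsub>G\<^esub> T (\<not> v) i = \<one>\<^bsub>G\<^esub>" if "i < length L" for v i using that by (rule T_cancel)
  show "A v [^]\<^bsub>G\<^esub> end_label v i \<otimes>\<^bsub>G\<^esub> T v i = T v i \<otimes>\<^bsub>G\<^esub> A (\<not> v) [^]\<^bsub>G\<^esub> end_label (\<not> v) i"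
    if i: "i < length L" for v i
  proof -
    let ?t = "T True i" and ?b = "A False [^]\<^bsub>G\<^esub> end_label False i" and ?a = "A True [^]\<^bsub>G\<^esub> end_label True i"
    have inv: "T False i = inv\<^bsub>G\<^esub> ?t"
      using TT[OF i, of False] T[OF i] by (simp add: inv_equality)
    have c: "?t \<in> carrier G" "?a \<in> carrier G" "?b \<in> carrier G" using A T[OF i] by auto
    have "?t \<otimes>\<^bsub>G\<^esub> (?b \<otimes>\<^bsub>G\<^esub> (inv\<^bsub>G\<^esub> ?t \<otimes>\<^bsub>G\<^esub> inv\<^bsub>G\<^esub> ?a)) = \<one>\<^bsub>G\<^esub>"
      using A_relation[OF i] A by (simp add: inv int_pow_neg)
    then have "?t \<otimes>\<^bsub>G\<^esub> ?b \<otimes>\<^bsub>G\<^esub> inv\<^bsub>G\<^esub> ?t \<otimes>\<^bsub>G\<^esub> inv\<^bsub>G\<^esub> ?a = \<one>\<^bsub>G\<^esub>"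
      using c by (simp add: m_assoc)
    then have "?t \<otimes>\<^bsub>G\<^esub> ?b \<otimes>\<^bsub>G\<^esub> inv\<^bsub>G\<^esub> ?t = ?a"
      using c by (metis inv_closed inv_equality inv_inv m_closed)
    then have rel: "?t \<otimes>\<^bsub>G\<^esub> ?b = ?a \<otimes>\<^bsub>G\<^esub> ?t"
      using c by (metis inv_solve_right m_closed)
    then have "?b \<otimes>\<^bsub>G\<^esub> inv\<^bsub>G\<^esub> ?t = inv\<^bsub>G\<^esub> ?t \<otimes>\<^bsub>G\<^esub> ?a"
      using c by (metis inv_closed inv_solve_left inv_solve_right m_assoc m_closed)
    with rel inv show ?thesis by (cases v) auto
  qed
qed

text \<open>Normal forms starting at \<open>V\<close> are acted on; edge \<open>0\<close>, which is trivial in the group,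
  identifies them with those starting at \<open>U\<close>.\<close>

primrec act_letter :: "(two_verts, nat) gog_gen \<times> bool \<Rightarrow> nform \<Rightarrow> nform" where
  "act_letter (g, b) x = (case g of
      Vertex_gen y \<Rightarrow> (case y of
          V \<Rightarrow> add True (if b then 1 else - 1) x
        | U \<Rightarrow> push 0 (add False (if b then 1 else - 1) (push 0 x)))
    | Edge_gen i \<Rightarrow> if b then push i (push 0 x) else push 0 (push i x))"

definition act :: "(two_verts, nat) gog_gen word \<Rightarrow> nform \<Rightarrow> nform" where
  "act w x = foldr act_letter w x"

lemma act_simps [simp]:
  "act [] x = x" "act (l # w) x = act_letter l (act w x)" "act (w @ w') x = act w (act w' x)"
  by (auto simp: act_def)

lemma T_0: "T v 0 = \<one>\<^bsub>G\<^esub>"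
proof -
  have "T True 0 = \<one>\<^bsub>G\<^esub>"
    using cls_relator[of "[(Edge_gen 0, True)]"] by (simp add: T_def rels_eq)
  then show ?thesis
    using T_not[of 0 True] L_nonempty by (cases v) auto
qed

lemma inv_A: "inv\<^bsub>G\<^esub> (A v) = cls [(Vertex_gen (vertex v), False)]"
  unfolding A_def cls_def gog_group_def
  by (subst class_inv[OF rels_words]) (simp_all add: word_inv_def)

lemma pushes [intro]:
  "valid True x \<Longrightarrow> i < length L \<Longrightarrow> valid False (push i x)"
  "valid False x \<Longrightarrow> i < length L \<Longrightarrow> valid True (push i x)"
  using valid_push[of False x i] valid_push[of True x i] by auto

lemma valid_act_letter:
  assumes "g \<in> gens" "valid True x"
  shows "valid True (act_letter (g, b) x)"
  using assms L_nonempty by (auto split: gog_gen.split two_verts.split intro!: valid_add pushes)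

lemma ev_act_letter:
  assumes g: "g \<in> gens" and x: "valid True x"
  shows "ev True (act_letter (g, b) x) = cls [(g, b)] \<otimes>\<^bsub>G\<^esub> ev True x"
proof (cases g)
  case (Edge_gen i)
  have i: "i < length L" "0 < length L" using g Edge_gen L_nonempty by auto
  then have "valid False (push j x)" if "j < length L" for j using x that by auto
  then show ?thesis
    using Edge_gen i x ev_push[of True "push 0 x" i] ev_push[of True "push i x" 0]
      ev_push[of False x i] ev_push[of False x 0]
    by (cases b) (simp_all add: T_0 T_def[symmetric])
next
  case (Vertex_gen y)
  have 0: "0 < length L" using L_nonempty by auto
  have c: "A v [^]\<^bsub>G\<^esub> (if b then 1 else - 1 :: int) = cls [(Vertex_gen (vertex v), b)]" for v
    using inv_A[of v] by (simp add: int_pow_neg A_def)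
  show ?thesis
  proof (cases y)
    case V
    then show ?thesis
      using Vertex_gen x ev_add[of True x "if b then 1 else - 1"] c[of True] by (simp add: vertex_def)
  next
    case U
    have 1: "valid False (push 0 x)" using x 0 by auto
    have 2: "valid False (add False (if b then 1 else - 1) (push 0 x))" using 1 by (rule valid_add)
    show ?thesis
      using U Vertex_gen x ev_push[of True, OF _ 0, of "add False (if b then 1 else - 1) (push 0 x)"] 2
        ev_add[OF 1, of "if b then 1 else - 1"] ev_push[of False x 0] 0 c[of False] 1
      by (simp add: T_0 vertex_def split del: if_split)
  qed
qed

lemma valid_act: "w \<in> words gens \<Longrightarrow> valid True x \<Longrightarrow> valid True (act w x)"
  by (induction w) (auto simp del: act_letter.simps intro!: valid_act_letter)

text \<open>Applied to \<open>Pt 0\<close> this gives existence: the resulting form evaluates to the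
  class of the word.\<close>

lemma ev_act: "w \<in> words gens \<Longrightarrow> valid True x \<Longrightarrow> ev True (act w x) = cls w \<otimes>\<^bsub>G\<^esub> ev True x"
proof (induction w)
  case Nil
  then show ?case by (simp add: cls_one[symmetric])
next
  case (Cons l w)
  obtain g b where l: "l = (g, b)" by fastforce
  show ?case
    using Cons cls_mult[of "[(g, b)]" w] valid_act[of w x] ev_act_letter[of g "act w x" b]
    by (simp add: l m_assoc[symmetric] del: act_letter.simps)
qed

lemma act_word_pow_V: "valid True x \<Longrightarrow> act (word_pow (Vertex_gen V) z) x = add True z x"
  by (induction rule: word_pow_induct) (auto simp: word_pow_def add_0 add_add)

lemma act_word_pow_U:
  assumes "valid True x"
  shows "act (word_pow (Vertex_gen U) z) x = push 0 (add False z (push 0 x))"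
proof (induction rule: word_pow_induct)
  have 0: "valid False (push 0 x)" using assms L_nonempty by auto
  {
    case zero
    then show ?case using 0 assms by (simp add: word_pow_def add_0 push_push)
  next
    case (plus z)
    then show ?case using 0 by (simp add: push_push[OF valid_add[OF 0]] add_add)
  next
    case (minus z)
    then show ?case using 0 by (simp add: push_push[OF valid_add[OF 0]] add_add)
  }
qed

text \<open>By \<open>push_add\<close>, crossing \<open>i\<close>, adding the label there and
  crossing back amounts to adding the label at \<open>V\<close>, which undoes the initial
  subtraction. Hence the presented group acts on the valid forms starting at
  \<open>V\<close>.\<close>

lemma act_relator:
  assumes "r \<in> rels" and x: "valid True x"
  shows "act r x = x"
proof -
  consider "r = [(Edge_gen 0, True)]" | i where "i < length L" "r = edge_relator (two_vertex_graph L) i"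
    using assms(1) unfolding rels_eq by blast
  then show ?thesis
  proof cases
    case 1
    then show ?thesis using push_push[OF x] by simp
  next
    case (2 i)
    let ?x = "add True (- end_label True i) x"
    have 0: "0 < length L" using L_nonempty by auto
    have v1: "valid True ?x" using x by (rule valid_add)
    then have v2: "valid False (push i ?x)" using 2(1) by auto
    then have v3: "valid True (push 0 (push i ?x))" using 0 by auto
    have "act r x = push i (add False (1 * end_label False i) (push i ?x))"
      using v2 v3 by (simp add: 2 edge_relator_eq act_word_pow_V[OF x] act_word_pow_U
          push_push[OF v2] push_push[OF valid_add[OF v2]])
    also have "\<dots> = add True (end_label True i) (push i (push i ?x))"
      using push_add[of True "push i ?x" i 1] v2 2(1) by simp
    also have "\<dots> = x"
      using x by (simp add: push_push[OF v1] add_add add_0)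
    finally show ?thesis .
  qed
qed

lemma act_cong: "(w, w') \<in> word_cong gens rels \<Longrightarrow> valid True x \<Longrightarrow> act w x = act w' x"
proof (induction arbitrary: x rule: word_cong.induct)
  case (cancel u w g b)
  have y: "valid True (act w x)" using cancel valid_act by simp
  have "act_letter (g, b) (act_letter (g, \<not> b) (act w x)) = act w x"
  proof (cases g)
    case (Edge_gen i)
    then have "i < length L" "0 < length L" using cancel(3) by auto
    then have "valid False (push j (act w x))" if "j \<in> {0, i}" for j using y that by auto
    then have "push 0 (push 0 (push i (act w x))) = push i (act w x)"
      "push i (push i (push 0 (act w x))) = push 0 (act w x)"
      by (simp_all add: push_push[of False])
    then show ?thesis using Edge_gen push_push[OF y] by simp
  next
    case (Vertex_gen z)
    have 0: "valid False (push 0 (act w x))" using y L_nonempty by auto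
    show ?thesis
      using Vertex_gen y 0 by (cases z) (auto simp: push_push[OF y] push_push[OF valid_add[OF 0]] add_add add_0)
  qed
  then show ?case by simp
next
  case (relator u w r)
  then show ?case using act_relator valid_act by simp
qed auto

definition class_act :: "(two_verts, nat) gog_gen word set \<Rightarrow> nform \<Rightarrow> nform" where
  "class_act g x = act (SOME w. w \<in> g) x"

lemma class_act_cls: "w \<in> words gens \<Longrightarrow> valid True x \<Longrightarrow> class_act (cls w) x = act w x"
proof -
  assume w: "w \<in> words gens" and x: "valid True x"
  have "w \<in> cls w" using w by (simp add: cls_def word_cong.refl)
  then have "(SOME w'. w' \<in> cls w) \<in> cls w" by (rule someI)
  then have "(w, SOME w'. w' \<in> cls w) \<in> word_cong gens rels" by (simp add: cls_def)
  from act_cong[OF this x] show ?thesis by (simp add: class_act_def)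
qed

lemma carrier_cls: "g \<in> carrier G \<Longrightarrow> \<exists>w\<in>words gens. g = cls w"
  by (auto simp: gog_group_def presented_group_def quotient_def cls_def)

lemma class_act_mult:
  assumes "g \<in> carrier G" "h \<in> carrier G" "valid True x"
  shows "class_act (g \<otimes>\<^bsub>G\<^esub> h) x = class_act g (class_act h x)"
  using carrier_cls[OF assms(1)] carrier_cls[OF assms(2)] assms(3)
  by (auto simp: cls_mult class_act_cls valid_act)

lemma class_act_A: "valid True x \<Longrightarrow> class_act (A v [^]\<^bsub>G\<^esub> z) x =
    (if v then add True z x else push 0 (add False z (push 0 x)))"
  unfolding A_def
  by (simp add: cls_pow[symmetric] class_act_cls word_pow_in_words vertex_def act_word_pow_V act_word_pow_U)

text \<open>Uniqueness by van der Waerden's method: a form is recovered from its group element by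
  letting the element act on the trivial form. Forms starting at \<open>U\<close> are read at
  \<open>V\<close> through edge \<open>0\<close>.\<close>

lemma class_act_ev:
  "valid v w \<Longrightarrow> class_act (ev v w) (Pt 0) = (if v then w else push 0 w)"
proof (induction w arbitrary: v)
  case (Pt c)
  then show ?case using class_act_A[of "Pt 0" True c] by simp
next
  case (St r i w)
  have i: "i < length L" "0 < length L" and w: "valid (\<not> v) w" "\<not> starts i w" and r: "0 \<le> r" "r < end_label v i"
    using St.prems L_nonempty by auto
  have s: "valid True (if \<not> v then w else push 0 w)" using w i by (cases v) auto
  have t: "class_act (T v i) y = (if v then push i (push 0 y) else push 0 (push i y))" if "valid True y" for y
    using that i by (simp add: T_def class_act_cls)
  have "valid v (St 0 i w)" using w i r by simp
  then have u: "valid v (push i w)" using w push_not_starts by simp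
  have a: "add v r (push i w) = St r i w" using w r by (simp add: push_not_starts add_0)
  have "class_act (ev v (St r i w)) (Pt 0) =
      class_act (A v [^]\<^bsub>G\<^esub> r) (class_act (T v i) (if \<not> v then w else push 0 w))"
    using i w St.IH[OF w(1)] by (simp add: class_act_mult t s)
  also have "\<dots> = class_act (A v [^]\<^bsub>G\<^esub> r) (if v then push i w else push 0 (push i w))"
    using push_push[OF w(1)] t[OF s] by (cases v) auto
  also have "\<dots> = (if v then St r i w else push 0 (St r i w))"
  proof (cases v)
    case True
    then show ?thesis using u a class_act_A[of "push i w" True r] by simp
  next
    case False
    then have "valid True (push 0 (push i w))" "valid False (push i w)" using u i by auto
    then show ?thesis
      using False a class_act_A[of "push 0 (push i w)" False r] push_push[of False "push i w" 0] by simp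
  qed
  finally show ?case .
qed

sublocale normal_forms G end_label "length L" A T
proof
  fix w w' assume "valid True w" "valid True w'" "ev True w = ev True w'"
  then show "w = w'" using class_act_ev by metis
next
  fix g assume "g \<in> carrier G"
  then obtain w where w: "w \<in> words gens" "g = cls w" using carrier_cls by blast
  then have "ev True (act w (Pt 0)) = g" by (simp add: ev_act)
  moreover have "valid True (act w (Pt 0))" using w by (simp add: valid_act)
  ultimately show "\<exists>w. valid True w \<and> ev True w = g" by blast
qed

end

section \<open>Depths\<close>

text \<open>The gcds are bounded by \<open>\<bar>s\<bar>\<close> and form a divisibility chain, so
  they are constant once the maximum is attained.\<close>

lemma gcd_chain_eventually_const:
  fixes f :: "nat \<Rightarrow> int"
  assumes chain: "\<And>i. f i dvd f (Suc i)" and s: "s \<noteq> 0"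
  shows "\<exists>d m. \<forall>i\<ge>m. gcd (f i) s = d"
proof -
  have mono: "f i dvd f j" if "i \<le> j" for i j
    using that by (induction j rule: dec_induct) (auto intro: dvd_trans chain)
  have "finite (range (\<lambda>i. gcd (f i) s))"
  proof (rule finite_subset)
    show "range (\<lambda>i. gcd (f i) s) \<subseteq> {0..\<bar>s\<bar>}"
      using s by (auto simp: zdvd_imp_le)
  qed simp
  then have "Max (range (\<lambda>i. gcd (f i) s)) \<in> range (\<lambda>i. gcd (f i) s)"
    by (intro Max_in) auto
  then obtain m where m: "gcd (f m) s = Max (range (\<lambda>i. gcd (f i) s))" by auto
  have "gcd (f i) s = gcd (f m) s" if "i \<ge> m" for i
  proof (rule zdvd_antisym_nonneg)
    have "gcd (f i) s \<le> gcd (f m) s"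
      unfolding m using \<open>finite _\<close> by (intro Max_ge) auto
    moreover have d: "gcd (f m) s dvd gcd (f i) s"
      using mono[OF that] by (meson dvd_trans gcd_dvd1 gcd_dvd2 gcd_greatest)
    moreover have "gcd (f i) s > 0" using s by simp
    ultimately have "gcd (f i) s = gcd (f m) s"
      by (meson antisym zdvd_imp_le)
    then show "gcd (f i) s dvd gcd (f m) s" "gcd (f m) s dvd gcd (f i) s" by simp_all
  qed simp_all
  then show ?thesis by blast
qed

text \<open>The two conditions on \<open>f\<close> define the subgroups generated by
  \<open>c div gcd c r\<close> and \<open>d div gcd d s\<close>; equal subgroups have equal positive
  generators.\<close>

lemma dvd_mult_iff_imp_eq:
  fixes c d r s :: int
  assumes "c > 0" "d > 0" and iff: "\<And>f. c dvd r * f \<longleftrightarrow> d dvd s * f"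
  shows "c * gcd d s = d * gcd c r"
proof -
  have red: "c dvd r * f \<longleftrightarrow> c div gcd c r dvd f" if "c > 0" for c r f :: int
  proof -
    have g: "gcd c r > 0" using that by simp
    have "c dvd r * f \<longleftrightarrow> (c div gcd c r) * gcd c r dvd (r div gcd c r * f) * gcd c r"
      by (simp add: algebra_simps)
    also have "\<dots> \<longleftrightarrow> c div gcd c r dvd r div gcd c r * f"
      using g by (subst dvd_times_right_cancel_iff) auto
    also have "\<dots> \<longleftrightarrow> c div gcd c r dvd f"
      using that by (intro coprime_dvd_mult_right_iff div_gcd_coprime) auto
    finally show ?thesis .
  qed
  have "c div gcd c r dvd f \<longleftrightarrow> d div gcd d s dvd f" for f
    using iff[of f] red assms(1,2) by simp
  then have "c div gcd c r dvd d div gcd d s" "d div gcd d s dvd c div gcd c r"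
    by (metis dvd_refl)+
  then have "c div gcd c r = d div gcd d s"
    using assms(1,2) by (intro zdvd_antisym_nonneg) (auto simp: pos_imp_zdiv_nonneg_iff)
  then show ?thesis
    using assms(1,2) by (metis dvd_div_mult_self gcd_dvd1 mult.assoc mult.commute)
qed

text \<open>With stable gcds \<open>d\<close> and \<open>d'\<close>, the quotient of the two matched
  depths gives \<open>n ^ (j' + 1) = p * n ^ j\<close>. This is impossible for \<open>p\<close>
  strictly between \<open>1\<close> and \<open>n\<close>.\<close>

lemma no_depth_match:
  fixes n p k r s :: int
  assumes n: "n > 1" and p: "1 < p" "p < n" "p dvd n" and k: "k > 0" and r: "r > 0" and s: "s \<noteq> 0"
    and odd: "\<And>i. \<exists>j. \<forall>f. n ^ (2 * i + 1) dvd r * f \<longleftrightarrow> k * n ^ j dvd s * f"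
    and even: "\<And>i. \<exists>j. \<forall>f. p * n ^ (2 * i) dvd r * f \<longleftrightarrow> k * n ^ j dvd s * f"
  shows False
proof -
  obtain d m where d: "\<And>i. i \<ge> m \<Longrightarrow> gcd (n ^ i) r = d"
    using gcd_chain_eventually_const[of "\<lambda>i. n ^ i" r] r by auto
  obtain d' m' where d': "\<And>i. i \<ge> m' \<Longrightarrow> gcd (k * n ^ i) s = d'"
    using gcd_chain_eventually_const[of "\<lambda>i. k * n ^ i" s] s by auto
  have pos: "d > 0" "d' > 0" using d[of m] d'[of m'] r s by auto
  \<comment> \<open>Large enough to stabilise the gcds with \<open>r\<close> and to push the depth
    beyond \<open>k * n ^ m' * d\<close>. The latter forces \<open>j \<ge> m'\<close>, which
    stabilises the gcd with \<open>s\<close>.\<close>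
  define i where "i = m + nat (k * n ^ m' * d)"
  have big: "k * n ^ m' * d < n ^ (2 * i)"
  proof -
    have "int l < n ^ (2 * l)" for l :: nat
    proof -
      have "l < 2 ^ l" by (rule less_exp)
      then have "int l < 2 ^ l" by (metis of_nat_less_iff of_nat_numeral of_nat_power)
      also have "\<dots> \<le> n ^ l" using n by (intro power_mono) auto
      also have "\<dots> \<le> n ^ (2 * l)" using n by (intro power_increasing) auto
      finally show ?thesis .
    qed
    moreover have "k * n ^ m' * d \<le> int i" using i_def by simp
    ultimately show ?thesis by (meson le_less_trans)
  qed
  have large: "j \<ge> m'" if "c * gcd (k * n ^ j) s = k * n ^ j * d" "n ^ (2 * i) \<le> c" for c j
  proof (rule ccontr)
    assume "\<not> j \<ge> m'"
    then have "k * n ^ j * d \<le> k * n ^ m' * d"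
      using n k pos by (intro mult_mono power_increasing) auto
    moreover have "gcd (k * n ^ j) s \<ge> 1" using s by (simp add: int_one_le_iff_zero_less)
    then have "c * 1 \<le> c * gcd (k * n ^ j) s"
      using that n by (intro mult_left_mono) (auto intro: order_trans[rotated])
    ultimately show False using that big by linarith
  qed
  obtain j where "\<And>f. n ^ (2 * i + 1) dvd r * f \<longleftrightarrow> k * n ^ j dvd s * f"
    using odd by blast
  then have 1: "n ^ (2 * i + 1) * gcd (k * n ^ j) s = k * n ^ j * d"
    using dvd_mult_iff_imp_eq[of "n ^ (2 * i + 1)" "k * n ^ j" r s] n k d[of "2 * i + 1"]
    by (simp add: i_def)
  have "j \<ge> m'" using n by (intro large[OF 1] power_increasing) auto
  with 1 d' have 1: "n ^ (2 * i + 1) * d' = k * n ^ j * d" by simp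
  obtain j' where "\<And>f. p * n ^ (2 * i) dvd r * f \<longleftrightarrow> k * n ^ j' dvd s * f"
    using even by blast
  \<comment> \<open>As \<open>p dvd n\<close>, this gcd lies in the divisibility order between those
    of \<open>n ^ (2 * i)\<close> and \<open>n ^ (2 * i + 1)\<close>, both equal to
    \<open>d\<close>.\<close>
  moreover have "gcd (p * n ^ (2 * i)) r = d"
  proof (rule zdvd_antisym_nonneg)
    have "p * n ^ (2 * i) dvd n ^ (2 * i + 1)" using p(3) by (simp add: mult_dvd_mono)
    then have "gcd (p * n ^ (2 * i)) r dvd gcd (n ^ (2 * i + 1)) r"
      by (meson dvd_trans gcd_dvd1 gcd_dvd2 gcd_greatest)
    moreover have "gcd (n ^ (2 * i + 1)) r = d" by (rule d) (simp add: i_def)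
    ultimately show "gcd (p * n ^ (2 * i)) r dvd d" by (simp only:)
    have "gcd (n ^ (2 * i)) r dvd gcd (p * n ^ (2 * i)) r"
      by (meson dvd_trans dvd_triv_right gcd_dvd1 gcd_dvd2 gcd_greatest)
    moreover have "gcd (n ^ (2 * i)) r = d" by (rule d) (simp add: i_def)
    ultimately show "d dvd gcd (p * n ^ (2 * i)) r" by (simp only:)
  qed (use pos in auto)
  ultimately have 2: "p * n ^ (2 * i) * gcd (k * n ^ j') s = k * n ^ j' * d"
    using dvd_mult_iff_imp_eq[of "p * n ^ (2 * i)" "k * n ^ j'" r s] n k p by simp
  have "j' \<ge> m'" using n p by (intro large[OF 2]) simp
  with 2 d' have 2: "p * n ^ (2 * i) * d' = k * n ^ j' * d" by simp
  have "(n ^ (2 * i) * d' * k * d) * n ^ (j' + 1) = (n ^ (2 * i + 1) * d') * (k * n ^ j' * d)"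
    by simp
  also have "\<dots> = (k * n ^ j * d) * (p * n ^ (2 * i) * d')"
    by (simp only: 1 2)
  also have "\<dots> = (n ^ (2 * i) * d' * k * d) * (p * n ^ j)"
    by simp
  finally have *: "n ^ (j' + 1) = p * n ^ j"
    using n k pos by (subst (asm) mult_cancel_left) auto
  show False
  proof (cases "j' + 1 \<le> j")
    case True
    then have "n ^ (j' + 1) \<le> n ^ j" using n by (intro power_increasing) auto
    moreover have "n ^ j * 1 < n ^ j * p" using n p by (intro mult_strict_left_mono) auto
    ultimately show False using * by (simp add: mult.commute)
  next
    case False
    then have "n ^ Suc j \<le> n ^ (j' + 1)" using n by (intro power_increasing) auto
    moreover have "n ^ j * p < n ^ j * n" using n p by (intro mult_strict_left_mono) auto
    ultimately show False using * by (simp add: mult.commute)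
  qed
qed

section \<open>Passage to finite-index subgroups\<close>

lemma (in group) finite_index_power_mem:
  assumes H: "subgroup H G" "finite (rcosets H)" and g: "g \<in> carrier G"
  shows "\<exists>M>0. g [^] (M::nat) \<in> H"
proof -
  have "range (\<lambda>i::nat. H #> g [^] i) \<subseteq> rcosets H"
    using g by (auto simp: RCOSETS_def)
  then have "\<not> inj (\<lambda>i::nat. H #> g [^] i)"
    using H(2) finite_imageD finite_subset infinite_UNIV_nat by blast
  then have "\<exists>i j. i < j \<and> H #> g [^] (i::nat) = H #> g [^] j"
    unfolding inj_def by (metis linorder_neqE_nat)
  then obtain i j where ij: "i < j" "H #> g [^] (i::nat) = H #> g [^] j" by blast
  have "g [^] j \<in> H #> g [^] i"
    using ij(2) g H(1) by (simp add: rcos_self)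
  then obtain h where h: "h \<in> H" "g [^] j = h \<otimes> g [^] i" by (auto simp: r_coset_def)
  have "g [^] (j - i) \<otimes> g [^] i = g [^] j" using g ij(1) by (simp add: nat_pow_mult)
  then have "g [^] (j - i) = h"
    using h g subgroup.mem_carrier[OF H(1)] by (metis nat_pow_closed right_cancel)
  with h ij(1) show ?thesis by (intro exI[of _ "j - i"]) auto
qed

text \<open>Because \<open>g0\<close> distorts a power of \<open>a\<close>, the isomorphism sends
  some power of \<open>a\<close> to a distorted element of \<open>G'\<close>, which has a power in
  the vertex group there. This fixes \<open>R\<close> and \<open>s\<close> for all \<open>g\<close>;
  then \<open>h\<close> is the image of a power of \<open>g\<close> in the subgroup.\<close>

lemma commensurable_transfer:
  fixes G (structure) and G' :: "('b, 'd) monoid_scheme" (structure)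
  assumes G: "normal_forms G lam m A T" and G': "normal_forms G' lam' m' A' T'"
    and comm: "abstractly_commensurable G' G"
    and g0: "g0 \<in> carrier G" "r > 0" "N \<ge> 2"
      "labeled_generators.carries G A g0 r (r * int N)"
  shows "\<exists>R>0. \<exists>s\<noteq>0. \<forall>g\<in>carrier G. \<exists>M>0. \<exists>h\<in>carrier G'. \<forall>f e.
    labeled_generators.carries G A (g [^]\<^bsub>G\<^esub> (M::nat)) (R * f) (R * e) \<longleftrightarrow>
    labeled_generators.carries G' A' h (s * f) (s * e)"
proof -
  interpret G: normal_forms G lam m A T by (rule G)
  interpret G': normal_forms G' lam' m' A' T' by (rule G')
  obtain H' H where H: "subgroup H G" "finite (rcosets\<^bsub>G\<^esub> H)" and H': "subgroup H' G'"
    and isom: "G'\<lparr>carrier := H'\<rparr> \<cong> G\<lparr>carrier := H\<rparr>"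
    using comm unfolding abstractly_commensurable_def by blast
  interpret K: group "G\<lparr>carrier := H\<rparr>" by (rule subgroup.subgroup_is_group[OF H(1) G.group_axioms])
  interpret K': group "G'\<lparr>carrier := H'\<rparr>" by (rule subgroup.subgroup_is_group[OF H' G'.group_axioms])
  obtain \<psi> where \<psi>: "\<psi> \<in> iso (G\<lparr>carrier := H\<rparr>) (G'\<lparr>carrier := H'\<rparr>)"
    using K'.iso_sym[OF isom] by (auto simp: is_iso_def)
  interpret hom: group_hom "G\<lparr>carrier := H\<rparr>" "G'\<lparr>carrier := H'\<rparr>" \<psi>
    using \<psi> by unfold_locales (simp add: iso_def)
  have inj: "\<psi> x = \<psi> y \<longleftrightarrow> x = y" if "x \<in> H" "y \<in> H" for x y
    using \<psi> that by (auto simp: iso_def bij_betw_def inj_on_def)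
  have img: "\<psi> x \<in> carrier G'" if "x \<in> H" for x
    using hom.hom_closed[of x] that subgroup.mem_carrier[OF H'] by simp
  have mult: "\<psi> (x \<otimes>\<^bsub>G\<^esub> y) = \<psi> x \<otimes>\<^bsub>G'\<^esub> \<psi> y" if "x \<in> H" "y \<in> H" for x y
    using hom.hom_mult[of x y] that by simp
  have mult_mem: "x \<otimes>\<^bsub>G\<^esub> y \<in> H" if "x \<in> H" "y \<in> H" for x y
    using that subgroup.m_closed[OF H(1)] by blast
  have int_mem: "x [^]\<^bsub>G\<^esub> (z::int) \<in> H" if "x \<in> H" for x z
    using G.int_pow_consistent[OF H(1) that] K.int_pow_closed[of x z] that by simp
  have int_pow: "\<psi> (x [^]\<^bsub>G\<^esub> (z::int)) = \<psi> x [^]\<^bsub>G'\<^esub> z" if "x \<in> H" for x z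
    using hom.hom_int_pow[of x z] that G.int_pow_consistent[OF H(1) that, of z]
      G'.int_pow_consistent[OF H', of "\<psi> x" z] hom.hom_closed[of x] by simp
  obtain M where M: "M > 0" "g0 [^]\<^bsub>G\<^esub> (M::nat) \<in> H"
    using G.finite_index_power_mem[OF H g0(1)] by blast
  obtain r' where r': "r' > 0" "(A True [^]\<^bsub>G\<^esub> r) [^]\<^bsub>G\<^esub> (r'::nat) \<in> H"
    using G.finite_index_power_mem[OF H, of "A True [^]\<^bsub>G\<^esub> r"] by auto
  \<comment> \<open>\<open>carries\<close> describes conjugation by \<open>inv g0\<close>, hence the
    inverse in \<open>?y\<close>; conjugation by \<open>?y\<close> raises \<open>?x\<close> to the
    power \<open>N ^ M\<close>.\<close>
  let ?x = "A True [^]\<^bsub>G\<^esub> (r * int r')" and ?y = "inv\<^bsub>G\<^esub> (g0 [^]\<^bsub>G\<^esub> M)"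
  have x: "?x \<in> H" using r'(2) by (simp add: G.int_pow_pow[symmetric] int_pow_int)
  have y: "?y \<in> H" using M(2) H(1) by (simp add: subgroup.m_inv_closed)
  have "inv\<^bsub>G\<^esub> g0 \<otimes>\<^bsub>G\<^esub> A True [^]\<^bsub>G\<^esub> r \<otimes>\<^bsub>G\<^esub> inv\<^bsub>G\<^esub> (inv\<^bsub>G\<^esub> g0) = A True [^]\<^bsub>G\<^esub> (r * int N)"
    using g0(1,4) unfolding G.carries_def by (simp add: G.m_assoc) (simp add: G.m_assoc[symmetric])
  also have "\<dots> = (A True [^]\<^bsub>G\<^esub> r) [^]\<^bsub>G\<^esub> N"
    by (simp add: G.int_pow_pow[symmetric] int_pow_int)
  finally have "(inv\<^bsub>G\<^esub> g0) [^]\<^bsub>G\<^esub> M \<otimes>\<^bsub>G\<^esub> A True [^]\<^bsub>G\<^esub> r \<otimes>\<^bsub>G\<^esub> inv\<^bsub>G\<^esub> ((inv\<^bsub>G\<^esub> g0) [^]\<^bsub>G\<^esub> M) =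
      (A True [^]\<^bsub>G\<^esub> r) [^]\<^bsub>G\<^esub> (N ^ M)"
    using g0(1) by (intro G.conj_nat_pow_iterate[symmetric]) auto
  then have "(?y \<otimes>\<^bsub>G\<^esub> A True [^]\<^bsub>G\<^esub> r \<otimes>\<^bsub>G\<^esub> inv\<^bsub>G\<^esub> ?y) [^]\<^bsub>G\<^esub> int r' = ((A True [^]\<^bsub>G\<^esub> r) [^]\<^bsub>G\<^esub> int (N ^ M)) [^]\<^bsub>G\<^esub> int r'"
    using g0(1) by (simp only: G.nat_pow_inv int_pow_int)
  then have yx: "?y \<otimes>\<^bsub>G\<^esub> ?x \<otimes>\<^bsub>G\<^esub> inv\<^bsub>G\<^esub> ?y = ?x [^]\<^bsub>G\<^esub> int (N ^ M)"
    using g0(1) G.conj_int_pow[of "A True [^]\<^bsub>G\<^esub> r" ?y "int r'"] by (simp add: G.int_pow_pow mult_ac)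
  have "?x \<otimes>\<^bsub>G\<^esub> inv\<^bsub>G\<^esub> ?y = inv\<^bsub>G\<^esub> ?y \<otimes>\<^bsub>G\<^esub> ?x [^]\<^bsub>G\<^esub> int (N ^ M)"
    unfolding yx[symmetric] using g0(1) by (simp add: G.m_assoc[symmetric])
  moreover have iy: "inv\<^bsub>G\<^esub> ?y \<in> H" using y H(1) by (simp add: subgroup.m_inv_closed)
  ultimately have "\<psi> ?x \<otimes>\<^bsub>G'\<^esub> \<psi> (inv\<^bsub>G\<^esub> ?y) = \<psi> (inv\<^bsub>G\<^esub> ?y) \<otimes>\<^bsub>G'\<^esub> \<psi> ?x [^]\<^bsub>G'\<^esub> int (N ^ M)"
    using x by (metis int_mem int_pow mult)
  then have "inv\<^bsub>G'\<^esub> (\<psi> (inv\<^bsub>G\<^esub> ?y)) \<otimes>\<^bsub>G'\<^esub> \<psi> ?x \<otimes>\<^bsub>G'\<^esub> inv\<^bsub>G'\<^esub> (inv\<^bsub>G'\<^esub> (\<psi> (inv\<^bsub>G\<^esub> ?y))) = \<psi> ?x [^]\<^bsub>G'\<^esub> (N ^ M)"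
    using img[OF x] img[OF iy]
    by (simp add: G'.m_assoc int_pow_int flip: of_nat_power) (simp add: G'.m_assoc[symmetric])
  moreover have "N ^ M \<ge> 2"
    using g0(3) M(1) self_le_power[of N M] by linarith
  ultimately obtain Q s where Q: "Q > 0" "\<psi> ?x [^]\<^bsub>G'\<^esub> (Q::nat) = A' True [^]\<^bsub>G'\<^esub> (s::int)"
    using G'.distorted_elliptic[of "\<psi> ?x" "inv\<^bsub>G'\<^esub> (\<psi> (inv\<^bsub>G\<^esub> ?y))" "N ^ M"] img[OF x] img[OF iy] by auto
  define R where "R = r * int r' * int Q"
  have R: "R > 0" using g0(2) r'(1) Q(1) by (simp add: R_def)
  have xQ: "?x [^]\<^bsub>G\<^esub> (int Q * z) = A True [^]\<^bsub>G\<^esub> (R * z)" for z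
    by (simp add: R_def G.int_pow_pow mult_ac)
  have AH: "A True [^]\<^bsub>G\<^esub> (R * z) \<in> H" for z
    using int_mem[OF x] by (metis xQ)
  have \<psi>A: "\<psi> (A True [^]\<^bsub>G\<^esub> (R * z)) = A' True [^]\<^bsub>G'\<^esub> (s * z)" for z
  proof -
    have "\<psi> (A True [^]\<^bsub>G\<^esub> (R * z)) = \<psi> ?x [^]\<^bsub>G'\<^esub> (int Q * z)"
      by (simp only: xQ[symmetric] int_pow[OF x])
    also have "\<dots> = (\<psi> ?x [^]\<^bsub>G'\<^esub> int Q) [^]\<^bsub>G'\<^esub> z"
      using img[OF x] by (simp add: G'.int_pow_pow)
    also have "\<dots> = A' True [^]\<^bsub>G'\<^esub> (s * z)"
      by (simp add: int_pow_int Q(2) G'.int_pow_pow)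
    finally show ?thesis .
  qed
  have s: "s \<noteq> 0"
  proof
    assume "s = 0"
    then have "\<psi> (A True [^]\<^bsub>G\<^esub> (R * 1)) = \<psi> (A True [^]\<^bsub>G\<^esub> (R * 0))" unfolding \<psi>A by simp
    then have "A True [^]\<^bsub>G\<^esub> (R * 1) = A True [^]\<^bsub>G\<^esub> (R * 0)"
      using inj[OF AH AH] by blast
    from G.A_pow_eq[OF this] R show False by simp
  qed
  have "\<exists>M>0. \<exists>h\<in>carrier G'. \<forall>f e.
      G.carries (g [^]\<^bsub>G\<^esub> (M::nat)) (R * f) (R * e) \<longleftrightarrow> G'.carries h (s * f) (s * e)"
    if g: "g \<in> carrier G" for g
  proof -
    obtain M where M: "M > 0" "g [^]\<^bsub>G\<^esub> (M::nat) \<in> H"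
      using G.finite_index_power_mem[OF H g] by blast
    have "G.carries (g [^]\<^bsub>G\<^esub> M) (R * f) (R * e) \<longleftrightarrow> G'.carries (\<psi> (g [^]\<^bsub>G\<^esub> M)) (s * f) (s * e)" for f e
      unfolding G.carries_def G'.carries_def \<psi>A[symmetric] mult[OF AH M(2), symmetric] mult[OF M(2) AH, symmetric]
      by (subst inj) (auto intro: mult_mem AH M(2))
    with M(1) img[OF M(2)] show ?thesis by blast
  qed
  with R s show ?thesis by blast
qed

section \<open>Transport along concatenated and repeated paths\<close>

context edge_labels begin

lemma path_subset: "valid v w \<Longrightarrow> set (path w) \<subseteq> {..<m}"
  by (induction w arbitrary: v) auto

lemma transports_append:
  "transports v (is @ js) f e \<longleftrightarrow>
    (\<exists>d. transports v is f d \<and> transports (if even (length is) then v else \<not> v) js d e)"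
  by (induction "is" arbitrary: v f) auto

text \<open>If \<open>c\<close> divides \<open>f\<close> then it divides \<open>f * \<mu>\<close>,
  so further copies of the path add no condition: the depth is unchanged under powers.\<close>

lemma transports_replicate:
  assumes "even (length is)" "c \<noteq> 0"
    and "\<And>f e. transports v is f e \<longleftrightarrow> c dvd f \<and> e = f * \<mu>" "M > 0"
  shows "transports v (concat (replicate M is)) f e \<longleftrightarrow> c dvd f \<and> e = f * \<mu> ^ M"
  using assms(4)
proof (induction M arbitrary: f e rule: nat_induct_non_zero)
  case 1
  then show ?case by (simp add: assms(3))
next
  case (Suc M)
  have "transports v (concat (replicate (Suc M) is)) f e \<longleftrightarrow>
      (\<exists>d. transports v is f d \<and> transports v (concat (replicate M is)) d e)"
    using assms(1) by (simp add: transports_append)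
  then show ?case
    by (auto simp: Suc.IH assms(3) mult_ac)
qed

end

lemma distinct_adj_concat_replicate:
  assumes "a \<noteq> b" "distinct_adj js" "js = [] \<or> hd js \<noteq> b"
  shows "distinct_adj (concat (replicate i [a, b]) @ js)"
  using assms
proof (induction i)
  case (Suc i)
  have "concat (replicate i [a, b]) @ js = [] \<or> hd (concat (replicate i [a, b]) @ js) \<noteq> b"
    using Suc.prems by (cases i) auto
  with Suc show ?case by (auto simp: distinct_adj_Cons)
qed simp

definition edges1 :: "nat \<Rightarrow> nat \<Rightarrow> (int \<times> int) list" where
  "edges1 k n = [(int k, int (k * n)), (int (k * n), int k)]"

definition edges3 :: "nat \<Rightarrow> nat \<Rightarrow> nat \<Rightarrow> (int \<times> int) list" where
  "edges3 k n p = replicate k (int n, 1) @ replicate (k - p) (1, int n) @ [(int p, int (p * n))]"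

lemma positive_edges1: "k > 0 \<Longrightarrow> n > 0 \<Longrightarrow> positive_two_vertex_graph (edges1 k n)"
  by unfold_locales (auto simp: edges1_def)

lemma positive_edges3: "n > 0 \<Longrightarrow> p > 0 \<Longrightarrow> positive_two_vertex_graph (edges3 k n p)"
  by unfold_locales (auto simp: edges3_def)

section \<open>All depths in \<open>G\<^sub>1\<close>\<close>

context
  fixes k n :: nat
  assumes kn: "k > 0" "n > 0"
begin

interpretation positive_two_vertex_graph "edges1 k n"
  using kn by (rule positive_edges1)

text \<open>Every edge has labels \<open>k\<close> and \<open>k * n\<close>, so the factor
  \<open>k\<close> persists while crossings only alter powers of \<open>n\<close>. The exponents
  \<open>a\<close> and \<open>b\<close> record the ratio of \<open>e\<close> to \<open>f\<close>
  without fractions.\<close>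

lemma transports_graph1:
  assumes "set is \<subseteq> {..<2}" "is \<noteq> []"
  shows "\<exists>j a b. \<forall>f e. transports v is f e \<longleftrightarrow> int k * int n ^ j dvd f \<and> e * int n ^ a = f * int n ^ b"
  using assms
proof (induction "is" arbitrary: v)
  case (Cons i "is")
  let ?k = "int k" and ?n = "int n"
  have k0: "?k \<noteq> 0" "?n \<noteq> 0" using kn by auto
  have i: "i = 0 \<or> i = 1" using Cons.prems by auto
  have labels: "(end_label v i = ?k \<and> end_label (\<not> v) i = ?k * ?n) \<or>
      (end_label v i = ?k * ?n \<and> end_label (\<not> v) i = ?k)"
    using i unfolding end_label_def by (auto simp: edges1_def)
  show ?case
  proof (cases "is = []")
    case True
    show ?thesis
      using labels
    proof
      assume l: "end_label v i = ?k \<and> end_label (\<not> v) i = ?k * ?n"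
      have "transports v (i # is) f e \<longleftrightarrow> ?k * ?n ^ 0 dvd f \<and> e * ?n ^ 0 = f * ?n ^ 1" for f e
        using True l by (auto simp: dvd_def mult_ac)
      then show ?thesis by blast
    next
      assume l: "end_label v i = ?k * ?n \<and> end_label (\<not> v) i = ?k"
      have "transports v (i # is) f e \<longleftrightarrow> ?k * ?n ^ 1 dvd f \<and> e * ?n ^ 1 = f * ?n ^ 0" for f e
        using True l k0 by (auto simp: dvd_def mult_ac)
      then show ?thesis by blast
    qed
  next
    case False
    then obtain j a b where IH:
      "\<And>f e. transports (\<not> v) is f e \<longleftrightarrow> ?k * ?n ^ j dvd f \<and> e * ?n ^ a = f * ?n ^ b"
      using Cons.IH[of "\<not> v"] Cons.prems by auto
    show ?thesis
      using labels
    proof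
      assume l: "end_label v i = ?k \<and> end_label (\<not> v) i = ?k * ?n"
      \<comment> \<open>For \<open>j = 0\<close> the first edge alone demands divisibility by
        \<open>k\<close>, which is what the truncated \<open>j - 1\<close> expresses.\<close>
      have "transports v (i # is) f e \<longleftrightarrow> ?k * ?n ^ (j - 1) dvd f \<and> e * ?n ^ a = f * ?n ^ Suc b" for f e
      proof -
        have "?k * ?n ^ j dvd q * (?k * ?n) \<longleftrightarrow> ?k * ?n ^ (j - 1) dvd q * ?k" for q
          using k0 by (cases j) (auto simp: mult_ac)
        then have "transports v (i # is) f e \<longleftrightarrow>
            (\<exists>q. f = q * ?k \<and> ?k * ?n ^ (j - 1) dvd f \<and> e * ?n ^ a = f * ?n ^ Suc b)"
          using l by (auto simp: IH mult_ac)
        then show ?thesis by (auto simp: dvd_def mult_ac)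
      qed
      then show ?thesis by blast
    next
      assume l: "end_label v i = ?k * ?n \<and> end_label (\<not> v) i = ?k"
      have "transports v (i # is) f e \<longleftrightarrow> ?k * ?n ^ Suc j dvd f \<and> e * ?n ^ Suc a = f * ?n ^ b" for f e
      proof -
        have "?k * ?n ^ j dvd q * ?k \<longleftrightarrow> ?k * ?n ^ Suc j dvd q * (?k * ?n)" for q
          using k0 by (auto simp: mult_ac)
        moreover have "e * ?n ^ a = q * ?k * ?n ^ b \<longleftrightarrow> e * ?n ^ Suc a = q * (?k * ?n) * ?n ^ b" for q
          using k0 by (auto simp: mult_ac)
        ultimately have "transports v (i # is) f e \<longleftrightarrow>
            (\<exists>q. f = q * (?k * ?n) \<and> ?k * ?n ^ Suc j dvd f \<and> e * ?n ^ Suc a = f * ?n ^ b)"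
          using l by (auto simp: IH)
        then show ?thesis by (auto simp: dvd_def mult_ac)
      qed
      then show ?thesis by blast
    qed
  qed
qed simp

lemma carries_graph1:
  assumes "h \<in> carrier G"
  shows "(\<forall>f e. carries h f e \<longleftrightarrow> f = e) \<or>
    (\<exists>j a b. \<forall>f e. carries h f e \<longleftrightarrow> int k * int n ^ j dvd f \<and> e * int n ^ a = f * int n ^ b)"
proof -
  obtain w where w: "valid True w" "h = ev True w" using surj_ev[OF assms] by blast
  have "length (edges1 k n) = 2" by (simp add: edges1_def)
  then have "set (path w) \<subseteq> {..<2}" using path_subset[OF w(1)] by simp
  then show ?thesis
    unfolding w(2) carries_ev_iff[OF w(1)]
    using transports_graph1[of "path w" True] by (cases "path w = []") auto
qed

end

section \<open>Loops of prescribed depth in \<open>G\<^sub>3\<close>\<close>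

context
  fixes k n p :: nat
  assumes k: "k > 1" and n: "n > 0" and p: "p > 0" "p < k"
begin

interpretation positive_two_vertex_graph "edges3 k n p"
  using n p(1) by (rule positive_edges3)

text \<open>The loops below use these edges. Two of type \<open>(n, 1)\<close> are at hand because
  \<open>k > 1\<close>, so a path leaving \<open>V\<close> across \<open>0\<close> can return across
  \<open>1\<close> without backtracking; edge \<open>k\<close> has type \<open>(1, n)\<close>
  because \<open>p < k\<close>.\<close>

lemma end_label_edges3:
  "end_label True 0 = int n" "end_label False 0 = 1" "end_label True 1 = int n" "end_label False 1 = 1"
  "end_label True k = 1" "end_label False k = int n"
  "end_label True (2 * k - p) = int p" "end_label False (2 * k - p) = int (p * n)"
  unfolding end_label_def using k p by (auto simp: edges3_def nth_append)

lemma transports_down: "transports True (concat (replicate i [0, k])) f e \<longleftrightarrow> f = e * int n ^ (2 * i)"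
proof (induction i arbitrary: f)
  case (Suc i)
  have "transports True [0, k] f d \<longleftrightarrow> f = d * int n ^ 2" for d
    by (auto simp: end_label_edges3 power2_eq_square mult_ac)
  then show ?case
    using transports_append[of True "[0, k]" "concat (replicate i [0, k])" f e] Suc
    by (auto simp: power_mult power2_eq_square mult_ac simp del: transports.simps)
qed auto

lemma transports_up: "transports True (concat (replicate i [k, 1])) f e \<longleftrightarrow> e = f * int n ^ (2 * i)"
proof (induction i arbitrary: f)
  case (Suc i)
  have "transports True [k, 1] f d \<longleftrightarrow> d = f * int n ^ 2" for d
    by (auto simp: end_label_edges3[unfolded One_nat_def] power2_eq_square mult_ac)
  then show ?case
    using transports_append[of True "[k, 1]" "concat (replicate i [k, 1])" f e] Suc
    by (auto simp: power_mult power2_eq_square mult_ac simp del: transports.simps)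
qed auto

text \<open>The path descends to level \<open>-2i\<close>, turns around along \<open>mid\<close> and climbs to level \<open>2\<close>, where a step
  up multiplies exponents by \<open>n\<close>; the divisibility constraint comes from the turn.\<close>

lemma transports_valley:
  assumes len: "length mid = 2" and l: "l \<le> 1"
    and mid: "\<And>f e. transports True mid f e \<longleftrightarrow> c dvd f \<and> e * int n ^ (2 * l) = f * int n ^ 2"
  shows "transports True (concat (replicate i [0, k]) @ mid @ concat (replicate (i + l) [k, 1])) f e \<longleftrightarrow>
    c * int n ^ (2 * i) dvd f \<and> e = f * int n ^ 2"
proof -
  have len: "even (length (concat (replicate i [a, b])))" for a b :: nat and i by (induction i) auto
  have "transports True (concat (replicate i [0, k]) @ mid @ concat (replicate (i + l) [k, 1])) f e \<longleftrightarrow>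
    (\<exists>d d'. f = d * int n ^ (2 * i) \<and> c dvd d \<and> d' * int n ^ (2 * l) = d * int n ^ 2 \<and> e = d' * int n ^ (2 * (i + l)))"
    unfolding transports_append transports_down
    using len[of i 0 k] assms(1) by (simp add: mid transports_up[unfolded One_nat_def])
  also have "\<dots> \<longleftrightarrow> c * int n ^ (2 * i) dvd f \<and> e = f * int n ^ 2"
  proof (intro iffI; elim exE conjE)
    fix d d' assume *: "f = d * int n ^ (2 * i)" "c dvd d" "d' * int n ^ (2 * l) = d * int n ^ 2"
      "e = d' * int n ^ (2 * (i + l))"
    have "e = (d' * int n ^ (2 * l)) * int n ^ (2 * i)"
      using *(4) by (simp add: power_add)
    with * show "c * int n ^ (2 * i) dvd f \<and> e = f * int n ^ 2"
      by (auto simp: mult_dvd_mono mult_ac)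
  next
    assume *: "c * int n ^ (2 * i) dvd f" "e = f * int n ^ 2"
    then obtain t where t: "f = c * int n ^ (2 * i) * t" by auto
    \<comment> \<open>Prepares the witness for \<open>d'\<close>; the truncated subtraction is exact
      because \<open>l \<le> 1\<close>.\<close>
    have "int n ^ (2 - 2 * l) * int n ^ (2 * l) = int n ^ 2"
      using l by (simp add: power_add[symmetric])
    then have eq: "(c * t * int n ^ (2 - 2 * l)) * int n ^ (2 * l) = c * t * int n ^ 2"
      by (simp add: mult.assoc)
    have sum: "int n ^ (2 * (i + l)) = int n ^ (2 * l) * int n ^ (2 * i)"
      by (simp add: power_add)
    have "e = ((c * t * int n ^ (2 - 2 * l)) * int n ^ (2 * l)) * int n ^ (2 * i)"
      unfolding eq *(2) t by (simp add: mult_ac)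
    then have e: "e = (c * t * int n ^ (2 - 2 * l)) * int n ^ (2 * (i + l))"
      by (simp only: sum mult.assoc)
    have f: "f = (c * t) * int n ^ (2 * i)"
      by (simp add: t mult_ac)
    show "\<exists>d d'. f = d * int n ^ (2 * i) \<and> c dvd d \<and>
        d' * int n ^ (2 * l) = d * int n ^ 2 \<and> e = d' * int n ^ (2 * (i + l))"
      using f eq e dvd_triv_left by blast
  qed
  finally show ?thesis .
qed

lemma edges3_bounds: "length (edges3 k n p) = 2 * k - p + 1" "0 < 2 * k - p" "1 < 2 * k - p" "k < 2 * k - p"
  using k p by (auto simp: edges3_def)

text \<open>The conditions on \<open>mid\<close> make the loop cyclically reduced;
  \<open>hd mid \<noteq> 1\<close> covers \<open>i = 0\<close>, where the loop begins with
  \<open>mid\<close>. The \<open>l\<close> extra climbs give the total factor \<open>n ^ 2\<close>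
  for either turn.\<close>

lemma depth_graph3:
  assumes len: "length mid = 2" and l: "l \<le> 1"
    and mid: "\<And>f e. transports True mid f e \<longleftrightarrow> c dvd f \<and> e * int n ^ (2 * l) = f * int n ^ 2"
    and ends: "set mid \<subseteq> {..2 * k - p}" "distinct_adj mid" "hd mid \<noteq> k" "last mid = 1" "hd mid \<noteq> 1"
    and c: "c \<noteq> 0"
  shows "\<exists>g\<in>carrier G. \<forall>M>0. \<forall>f e.
    carries (g [^]\<^bsub>G\<^esub> (M::nat)) f e \<longleftrightarrow>
      c * int n ^ (2 * i) dvd f \<and> e = f * (int n ^ 2) ^ M"
proof -
  let ?P = "concat (replicate i [0, k]) @ mid @ concat (replicate (i + l) [k, 1])"
  have sub: "set (concat (replicate i [a, b])) \<subseteq> {a, b}" for a b :: nat and i by (induction i) auto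
  have ev: "even (length (concat (replicate i [a, b])))" for a b :: nat and i by (induction i) auto
  have nonempty: "mid \<noteq> []" using len by auto
  have 1: "set ?P \<subseteq> {..<length (edges3 k n p)}"
    using sub[of i 0 k] sub[of "i + l" k 1] ends(1) edges3_bounds by fastforce
  have 2: "even (length ?P)"
    using ev[of i 0 k] ev[of "i + l" k 1] len by simp
  have tail: "distinct_adj (concat (replicate (i + l) [k, 1]))"
    using distinct_adj_concat_replicate[of k 1 "[]" "i + l"] k by simp
  moreover have "concat (replicate (i + l) [k, 1]) = [] \<or> hd (concat (replicate (i + l) [k, 1])) \<noteq> 1"
    using k by (cases "i + l") auto
  ultimately have "distinct_adj (mid @ concat (replicate (i + l) [k, 1]))"
    using ends(2,4) by (auto simp: distinct_adj_append_iff)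
  then have 3: "distinct_adj ?P"
    using nonempty ends(3) k by (intro distinct_adj_concat_replicate) auto
  have "hd ?P \<noteq> 1" using nonempty ends(5) by (cases i) auto
  moreover have "last ?P = 1"
  proof (cases "i + l")
    case 0
    then show ?thesis using ends(4) nonempty by simp
  next
    case (Suc t)
    have "concat (replicate t [k, 1]) @ [k, 1] = concat (replicate (Suc t) [k, 1])"
      by (induction t) auto
    then have "concat (replicate (Suc t) [k, 1]) = concat (replicate t [k, 1]) @ [k, 1]" by simp
    then show ?thesis unfolding Suc by simp
  qed
  ultimately have 5: "last ?P \<noteq> hd ?P" by simp
  have 4: "?P \<noteq> []" using nonempty by simp
  have tr: "transports True ?P f e \<longleftrightarrow> c * int n ^ (2 * i) dvd f \<and> e = f * int n ^ 2" for f e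
    using len l mid by (rule transports_valley)
  have "carries (ev True (walk ?P) [^]\<^bsub>G\<^esub> M) f e \<longleftrightarrow>
      c * int n ^ (2 * i) dvd f \<and> e = f * (int n ^ 2) ^ M" if "M > 0" for M :: nat and f e
    unfolding carries_power_iff[OF 1 2 3 4 5]
    using 2 _ tr that by (rule transports_replicate) (use c n in simp)
  moreover have "ev True (walk ?P) \<in> carrier G"
    using valid_walk[OF 1, of True] 2 3 by (intro ev_closed) auto
  ultimately show ?thesis by blast
qed

text \<open>The turn \<open>[0, 1]\<close> demands divisibility by \<open>n\<close> but preserves
  the exponent, so one further climb, \<open>l = 1\<close>, supplies the factor.\<close>

lemma odd_depth_graph3:
  "\<exists>g\<in>carrier G. \<forall>M>0. \<forall>f e.
    carries (g [^]\<^bsub>G\<^esub> (M::nat)) f e \<longleftrightarrow>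
      int n ^ (2 * i + 1) dvd f \<and> e = f * (int n ^ 2) ^ M"
proof -
  have "transports True [0, 1] f e \<longleftrightarrow> int n dvd f \<and> e * int n ^ (2 * 1) = f * int n ^ 2" for f e
    using n by (auto simp: end_label_edges3[unfolded One_nat_def] dvd_def mult_ac)
  from depth_graph3[OF _ _ this, of i] show ?thesis
    using n k edges3_bounds by (simp add: mult.commute)
qed

text \<open>The turn across the edge with labels \<open>p\<close> and \<open>p * n\<close> and back
  across \<open>1\<close> demands divisibility by \<open>p\<close> and already multiplies by
  \<open>n ^ 2\<close>, so \<open>l = 0\<close>.\<close>

lemma even_depth_graph3:
  "\<exists>g\<in>carrier G. \<forall>M>0. \<forall>f e.
    carries (g [^]\<^bsub>G\<^esub> (M::nat)) f e \<longleftrightarrow>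
      int p * int n ^ (2 * i) dvd f \<and> e = f * (int n ^ 2) ^ M"
proof -
  have "transports True [2 * k - p, 1] f e \<longleftrightarrow> int p dvd f \<and> e * int n ^ (2 * 0) = f * int n ^ 2" for f e
  proof -
    have "transports True [2 * k - p, 1] f e \<longleftrightarrow>
        (\<exists>x. f = x * int p \<and> (\<exists>y. x * int (p * n) = y * 1 \<and> y * int n = e))"
      by (simp only: transports.simps not_True_eq_False not_False_eq_True end_label_edges3)
    then show ?thesis
      by (auto simp: dvd_def power2_eq_square mult_ac)
  qed
  from depth_graph3[OF _ _ this, of i] show ?thesis
    using p k edges3_bounds by simp
qed

end

section \<open>Comparison of the depths of the two groups\<close>

theorem theorem7p1:
  fixes k n p :: nat
  assumes "k > 1" and "n > 1"
    and "p > 0" and "p dvd n" and "p \<noteq> 1" and "p \<noteq> n" and "p < k"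
  shows "\<not> abstractly_commensurable (G1 k n) (G3 k n p)"
proof
  assume comm: "abstractly_commensurable (G1 k n) (G3 k n p)"
  have k: "k > 0" and n: "n > 0" using assms by auto
  interpret g1: positive_two_vertex_graph "edges1 k n"
    using k n by (rule positive_edges1)
  interpret g3: positive_two_vertex_graph "edges3 k n p"
    using n assms(3) by (rule positive_edges3)
  have G1: "G1 k n = g1.G" and G3: "G3 k n p = g3.G"
    by (simp_all add: G1_def G3_def graph1_def graph3_def edges1_def edges3_def)
  note odd3 = odd_depth_graph3[OF assms(1) n assms(3,7)] and even3 = even_depth_graph3[OF assms(1) n assms(3,7)]
  \<comment> \<open>The loop of depth \<open>n\<close> is the distorting element for the transfer:
    it carries \<open>n\<close> to \<open>n * n ^ 2\<close>.\<close>
  obtain g0 where g0: "g0 \<in> carrier g3.G" and "\<forall>M>0. \<forall>f e.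
      g3.carries (g0 [^]\<^bsub>g3.G\<^esub> (M::nat)) f e \<longleftrightarrow> int n ^ (2 * 0 + 1) dvd f \<and> e = f * (int n ^ 2) ^ M"
    using odd3[of 0] by (rule bexE)
  from this(2)[rule_format, of 1 "int n" "int n * int (n ^ 2)"] g0
  have "g3.carries g0 (int n) (int n * int (n ^ 2))" by simp
  moreover have "n ^ 2 \<ge> 2" using assms(2) self_le_power[of n 2] by simp
  moreover have "int n > 0" using n by simp
  ultimately have "\<exists>R>0. \<exists>s\<noteq>0. \<forall>g\<in>carrier g3.G. \<exists>M>0. \<exists>h\<in>carrier g1.G. \<forall>f e.
      g3.carries (g [^]\<^bsub>g3.G\<^esub> (M::nat)) (R * f) (R * e) \<longleftrightarrow> g1.carries h (s * f) (s * e)"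
    by (intro commensurable_transfer[OF g3.normal_forms_axioms g1.normal_forms_axioms comm[unfolded G1 G3] g0])
  then obtain R s where R: "R > 0" and s: "s \<noteq> 0" and
    tr: "\<And>g. g \<in> carrier g3.G \<Longrightarrow> \<exists>M>0. \<exists>h\<in>carrier g1.G. \<forall>f e.
      g3.carries (g [^]\<^bsub>g3.G\<^esub> (M::nat)) (R * f) (R * e) \<longleftrightarrow> g1.carries h (s * f) (s * e)"
    by blast
  have match: "\<exists>j. \<forall>f. c dvd R * f \<longleftrightarrow> int k * int n ^ j dvd s * f"
    if c: "c > 0" and ex: "\<exists>g\<in>carrier g3.G. \<forall>M>0. \<forall>f e.
      g3.carries (g [^]\<^bsub>g3.G\<^esub> (M::nat)) f e \<longleftrightarrow> c dvd f \<and> e = f * (int n ^ 2) ^ M" for c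
  proof -
    obtain g where g: "g \<in> carrier g3.G" and g_carries: "\<forall>M>0. \<forall>f e.
        g3.carries (g [^]\<^bsub>g3.G\<^esub> (M::nat)) f e \<longleftrightarrow> c dvd f \<and> e = f * (int n ^ 2) ^ M"
      using ex by (rule bexE)
    obtain M h where M: "M > 0" and h: "h \<in> carrier g1.G" and h_carries: "\<And>f e.
        g3.carries (g [^]\<^bsub>g3.G\<^esub> (M::nat)) (R * f) (R * e) \<longleftrightarrow> g1.carries h (s * f) (s * e)"
      using tr[OF g] by blast
    define \<mu> where "\<mu> = (int n ^ 2) ^ M"
    have \<mu>: "\<mu> > 1" using assms(2) M by (simp add: \<mu>_def one_less_power)
    have iff: "c dvd R * f \<longleftrightarrow> g1.carries h (s * f) (s * (f * \<mu>))" for f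
      using g_carries M h_carries[of f "f * \<mu>"] by (simp add: \<mu>_def)
    from carries_graph1[OF k n h] show ?thesis
    proof (elim disjE exE)
      \<comment> \<open>The trivial path preserves exponents, which contradicts
        \<open>\<mu> > 1\<close> at the nonzero exponent given by \<open>f = c\<close>.\<close>
      assume "\<forall>f e. g1.carries h f e \<longleftrightarrow> f = e"
      then have "s * c = s * (c * \<mu>)" using iff[of c] by simp
      then show ?thesis using s c \<mu> by simp
    next
      fix j a b
      assume "\<forall>f e. g1.carries h f e \<longleftrightarrow> int k * int n ^ j dvd f \<and> e * int n ^ a = f * int n ^ b"
      then have iff': "c dvd R * f \<longleftrightarrow>
          int k * int n ^ j dvd s * f \<and> s * (f * \<mu>) * int n ^ a = s * f * int n ^ b" for f
        using iff by blast
      \<comment> \<open>At \<open>f = c\<close> the left side holds, which pins down the ratio. The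
        ratio condition then holds for every \<open>f\<close>, leaving the divisibility
        condition.\<close>
      have "s * (c * \<mu>) * int n ^ a = s * c * int n ^ b" using iff'[of c] by simp
      then have "\<mu> * int n ^ a = int n ^ b" using s c by (simp add: mult.assoc)
      then have "s * (f * \<mu>) * int n ^ a = s * f * int n ^ b" for f by (simp add: mult.assoc)
      then show ?thesis using iff' by blast
    qed
  qed
  show False
  proof (rule no_depth_match)
    show "int n > 1" "int k > 0" "int p dvd int n" "R > 0" "s \<noteq> 0" "1 < int p"
      using assms R s by auto
    show "int p < int n" using assms dvd_imp_le[of p n] by simp
    show "\<exists>j. \<forall>f. int n ^ (2 * i + 1) dvd R * f \<longleftrightarrow> int k * int n ^ j dvd s * f" for i
      by (rule match[OF _ odd3]) (use n in simp)
    show "\<exists>j. \<forall>f. int p * int n ^ (2 * i) dvd R * f \<longleftrightarrow> int k * int n ^ j dvd s * f" for i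
      by (rule match[OF _ even3]) (use n assms(3) in simp)
  qed
qed

end
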